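(* Let $(X,Y),(X_1,Y_1),\dots,(X_n,Y_n)$ be i.i.d. pairs of random variables such that $$Y=s_\star(X)+\sigma(X)\varepsilon,\qquad \mathbb E(\varepsilon|X)=0,\quad\mathbb E(\varepsilon^2|X)=1,\quad s_\star,\sigma\in L^2(P_X).$$ Let $S\subset L^2(P_X)$ be a linear space of functions, let $s_o$ be the orthogonal projection of $s_\star$ onto $S$ in $L^2(P_X)$, and assume that there are finite constants $D$ and $M_\Psi$ such that $$\mathbb E\left((Y-s_o(X))^2\Psi(X)\right)\le D,\qquad\mathbb E(\Psi^2(X))\le M_\Psi .$$ Let $\delta>0$ be such that $\lceil\ln(\delta^{-2})\rceil\le n/2$. Let $V=\lceil\ln(\delta^{-2})\rceil\vee8$, assume $V\le n/2$, and let $(B_1,\dots,B_V)$ be a regular partition of $\{1,\dots,n\}$. For all $K=1,\dots,V$ let $\hat s_K=\arg\min_{t\in S}P_{B_K}\gamma(t)$ and let $\hat s_{K_\star}$ be the estimator with $$K_\star\in\arg\min_{K=1,\dots,V}\ \max_{K'=1,\dots,V}\left\{\overline P_{K,K'}\left(\gamma(\hat s_K)-\gamma(\hat s_{K'})\right)\right\}.$$ If $96\,e\,M_\Psi V\le n$, then, for $L_7=384+128\sqrt2\,e\,L_1$, $$\mathbb P\left(\ell(\hat s_{K_\star},s_\star)\le\ell(s_o,s_\star)+L_7\frac{DV}n\right)\ge1-3\delta .$$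
   Context: $P_X$ is the distribution of $X$; $\gamma(t)(x,y)=(y-t(x))^2$; $\ell(t,s_\star)=\mathbb E[\gamma(t)(X,Y)-\gamma(s_\star)(X,Y)]=\mathbb E[(t(X)-s_\star(X))^2]$ (for data-dependent $t$, the expectation is over $(X,Y)$, independent of the sample, only). $\Psi=\sup\{t^2:\ t\in S,\ \|t\|_{L^2(P_X)}\le1\}$, equivalently $\Psi=\sum_\lambda\psi_\lambda^2$ for an orthonormal basis $(\psi_\lambda)$ of $S$ in $L^2(P_X)$. A partition $(B_1,\dots,B_V)$ of $\{1,\dots,n\}$ is regular if $|\mathrm{Card}(B_K)-n/V|\le1$ for all $K$. $P_{B_J}f=\frac1{\mathrm{Card}(B_J)}\sum_{i\in B_J}f(X_i,Y_i)$ and $\overline P_{K,K'}f=\mathrm{Med}\{P_{B_J}f:\ J\ne K,K'\}$, where $\mathrm{Med}(a_1,\dots,a_N)$ is any real $b$ with $\mathrm{Card}\{i: a_i\le b\}\ge N/2$ and $\mathrm{Card}\{i:a_i\ge b\}\ge N/2$. $L_1=\sqrt{2/r}$ with $r=(1-\sqrt{1-e^{-2}})/2$ (so $L_1\le2\sqrt{6e}$). $a\vee b=\max(a,b)$. *)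

theory Defs
  imports "HOL-Probability.Probability"
begin

text \<open>Elements of $L^2(P)$ are genuine functions, not classes modulo null sets: the contrast and
  the envelope below evaluate them at points.\<close>

definition L2_space :: "'a measure \<Rightarrow> ('a \<Rightarrow> real) set" where
  "L2_space P = {f \<in> borel_measurable P. integrable P (\<lambda>x. (f x)\<^sup>2)}"

definition L2_norm :: "'a measure \<Rightarrow> ('a \<Rightarrow> real) \<Rightarrow> real" where
  "L2_norm P f = sqrt (\<integral>x. (f x)\<^sup>2 \<partial>P)"

definition linear_space :: "('a \<Rightarrow> real) set \<Rightarrow> bool" where
  "linear_space S \<longleftrightarrow> (\<lambda>_. 0) \<in> S \<and>
     (\<forall>f\<in>S. \<forall>g\<in>S. (\<lambda>x. f x + g x) \<in> S) \<and> (\<forall>c. \<forall>f\<in>S. (\<lambda>x. c * f x) \<in> S)"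

definition orth_proj :: "'a measure \<Rightarrow> ('a \<Rightarrow> real) set \<Rightarrow> ('a \<Rightarrow> real) \<Rightarrow> ('a \<Rightarrow> real) \<Rightarrow> bool" where
  "orth_proj P S s p \<longleftrightarrow> p \<in> S \<and> (\<forall>t\<in>S. (\<integral>x. (s x - p x) * t x \<partial>P) = 0)"

text \<open>The pointwise supremum of $t^2$ over the unit ball of $S$; it may be infinite.\<close>

definition Psi :: "'a measure \<Rightarrow> ('a \<Rightarrow> real) set \<Rightarrow> 'a \<Rightarrow> ennreal" where
  "Psi P S x = (SUP t\<in>{t\<in>S. L2_norm P t \<le> 1}. ennreal ((t x)\<^sup>2))"

definition contrast :: "('a \<Rightarrow> real) \<Rightarrow> 'a \<times> real \<Rightarrow> real" where
  "contrast t = (\<lambda>(x, y). (y - t x)\<^sup>2)"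

text \<open>For a data-dependent \<open>t\<close> this is applied to the realised function, so the integration is
  over the generic pair only.\<close>

definition excess_risk ::
  "'w measure \<Rightarrow> ('w \<Rightarrow> 'a \<times> real) \<Rightarrow> ('a \<Rightarrow> real) \<Rightarrow> ('a \<Rightarrow> real) \<Rightarrow> real" where
  "excess_risk M Z t s = (\<integral>\<omega>. contrast t (Z \<omega>) - contrast s (Z \<omega>) \<partial>M)"

definition regular_partition :: "nat \<Rightarrow> nat \<Rightarrow> (nat \<Rightarrow> nat set) \<Rightarrow> bool" where
  "regular_partition n V B \<longleftrightarrow>
     disjoint_family_on B {1..V} \<and> (\<Union>K\<in>{1..V}. B K) = {1..n} \<and>
     (\<forall>K\<in>{1..V}. \<bar>real (card (B K)) - real n / real V\<bar> \<le> 1)"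

definition emp_mean :: "nat set \<Rightarrow> (nat \<Rightarrow> 'z) \<Rightarrow> ('z \<Rightarrow> real) \<Rightarrow> real" where
  "emp_mean I z f = (\<Sum>i\<in>I. f (z i)) / real (card I)"

definition is_median :: "'i set \<Rightarrow> ('i \<Rightarrow> real) \<Rightarrow> real \<Rightarrow> bool" where
  "is_median I a b \<longleftrightarrow>
     real (card {i\<in>I. a i \<le> b}) \<ge> real (card I) / 2 \<and>
     real (card {i\<in>I. a i \<ge> b}) \<ge> real (card I) / 2"

text \<open>\<open>estimator_from M N Z I s\<close>: the random function \<open>s\<close> is computed, jointly measurably in the
  data and the evaluation point, from the observations \<open>Z i\<close> with \<open>i \<in> I\<close> alone.\<close>

definition estimator_from ::
  "'w measure \<Rightarrow> 'a measure \<Rightarrow> (nat \<Rightarrow> 'w \<Rightarrow> 'a \<times> real) \<Rightarrow> nat set \<Rightarrow>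
     ('w \<Rightarrow> 'a \<Rightarrow> real) \<Rightarrow> bool" where
  "estimator_from M N Z I s \<longleftrightarrow>
     (\<exists>h \<in> borel_measurable (PiM I (\<lambda>_. N \<Otimes>\<^sub>M borel) \<Otimes>\<^sub>M N).
        \<forall>\<omega>\<in>space M. \<forall>x\<in>space N. s \<omega> x = h (\<lambda>i\<in>I. Z i \<omega>, x))"

definition r_const :: real where
  "r_const = (1 - sqrt (1 - exp (-2))) / 2"

definition L1 :: real where
  "L1 = sqrt (2 / r_const)"

definition L7 :: real where
  "L7 = 384 + 128 * sqrt 2 * exp 1 * L1"

end

theory Submission
  imports Defs
begin

text \<open>
  Since \<open>E \<Psi>\<^sup>2\<close> is finite, \<open>S\<close> has a finite orthonormal basis \<open>\<psi>\<^sub>j\<close> away from a null set, and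
  \<open>\<Sum>\<^sub>j \<psi>\<^sub>j\<^sup>2 \<le> \<Psi>\<close>. Write \<open>u = t - s_o\<close> and \<open>a\<^sup>2 = 12 e D V / n\<close>, and call a block \<open>B\<close> good if
  \<open>\<bar>P\<^sub>B u\<^sup>2 - \<parallel>u\<parallel>\<^sup>2\<bar> \<le> \<parallel>u\<parallel>\<^sup>2 / 2\<close> and \<open>\<bar>P\<^sub>B (y - s_o) u\<bar> \<le> a \<parallel>u\<parallel>\<close> hold uniformly in \<open>u \<in> S\<close>. In
  coordinates these are bounds on the Frobenius norm of the empirical Gram matrix minus the identity
  and on a Euclidean norm, and second moments show that a block is bad with probability at most
  \<open>1/(12e) + 1/(6e) = 1/(4e)\<close>. The blocks being independent, a union bound over sets of blocks shows
  that fewer than \<open>(V - 2)/2\<close> blocks are bad, except with probability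
  \<open>1.1 e exp(-V/2) \<le> 3 \<delta>\<close>.

  Uniformity makes independence between an estimator and the blocks testing it unnecessary: each of
  the medians lies between two values taken on good blocks, and a good block estimator has
  \<open>\<parallel>u\<parallel> \<le> 2 a\<close> by its normal equation. Comparing the selected estimator with a good one gives
  \<open>\<parallel>u\<parallel> \<le> 9 a\<close>, and \<open>81 * 12 e \<le> L\<^sub>7\<close>.
\<close>

section \<open>Binomial coefficients and medians\<close>

text \<open>By Pascal's rule the largest coefficient at most doubles when \<open>V\<close> grows by
  one, so its ratio to \<open>2 ^ V\<close> never exceeds the value 70/256 taken at
  \<open>V = 8\<close>.\<close>

lemma central_binomial_bound:
  fixes V k :: nat
  assumes "8 \<le> V"
  shows "256 * (V choose k) \<le> 70 * 2 ^ V"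
  using assms
proof (induction V arbitrary: k rule: dec_induct)
  case base
  have "(8 choose k) \<le> 8 choose 4"
    using binomial_maximum'[of 4 k] by simp
  moreover have "(8 choose 4 :: nat) = 70"
    by (simp add: eval_nat_numeral)
  ultimately show ?case by simp
next
  case (step V)
  show ?case
  proof (cases k)
    case 0
    then show ?thesis using step.IH[of 0] by simp
  next
    case (Suc j)
    then show ?thesis using step.IH[of j] step.IH[of k] by simp
  qed
qed

text \<open>Otherwise every index with value at most \<open>b\<close> would violate
  \<open>G\<close>; but these are at least half of all indices, and the violating ones are fewer
  than half.\<close>

lemma median_le_witness:
  fixes a :: "'i \<Rightarrow> real"
  assumes "finite I" "is_median I a b" "2 * card {i\<in>I. \<not> G i} < card I"
  shows "\<exists>i\<in>I. G i \<and> a i \<le> b"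
proof (rule ccontr)
  assume "\<not> ?thesis"
  then have "card {i\<in>I. a i \<le> b} \<le> card {i\<in>I. \<not> G i}"
    using assms(1) by (intro card_mono) auto
  with assms show False unfolding is_median_def by linarith
qed

lemma is_median_uminus: "is_median I (\<lambda>i. - a i) (- b) \<longleftrightarrow> is_median I a b"
  unfolding is_median_def by auto

lemma median_ge_witness:
  fixes a :: "'i \<Rightarrow> real"
  assumes "finite I" "is_median I a b" "2 * card {i\<in>I. \<not> G i} < card I"
  shows "\<exists>i\<in>I. G i \<and> b \<le> a i"
  using median_le_witness[of I "\<lambda>i. - a i" "- b" G] assms by (simp add: is_median_uminus)

text \<open>For \<open>k = (V - 1) div 2\<close> one has \<open>V \<le> 2 * k + 2\<close>, so the
  binomial coefficient is at most a constant times \<open>4 ^ k\<close>. The 4 in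
  \<open>1 / (4 * exp 1)\<close> cancels this power and leaves \<open>exp (- k)\<close>.\<close>

lemma binomial_exp_bound:
  assumes V: "8 \<le> V" and \<delta>: "exp (- real V / 2) \<le> \<delta>"
  shows "real (V choose ((V - 1) div 2)) * (1 / (4 * exp 1)) ^ ((V - 1) div 2) \<le> 3 * \<delta>"
proof -
  define k where "k = (V - 1) div 2"
  have k: "V \<le> 2 * k + 2" unfolding k_def using V by linarith
  have "real (256 * (V choose k)) \<le> real (70 * 2 ^ V)"
    using central_binomial_bound[OF V, of k] by (simp only: of_nat_le_iff)
  also have "\<dots> \<le> 70 * 2 ^ (2 * k + 2)"
    using power_increasing[OF k, of "2 :: real"] by simp
  also have "\<dots> = 280 * 4 ^ k" by (simp add: power_add power_mult)
  finally have b: "real (V choose k) \<le> 280 / 256 * 4 ^ k" by simp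
  have "real (V choose k) * (1 / (4 * exp 1)) ^ k \<le> 280 / 256 * 4 ^ k * (1 / (4 * exp 1)) ^ k"
    using b by (intro mult_right_mono) auto
  also have "\<dots> = 280 / 256 * exp (- real k)"
    by (simp add: power_divide power_mult_distrib exp_minus field_simps flip: exp_of_nat_mult)
  also have "\<dots> \<le> 280 / 256 * exp (1 - real V / 2)" using k by simp
  also have "\<dots> = 280 / 256 * exp 1 * exp (- real V / 2)"
    using exp_add[of 1 "- real V / 2"] by simp
  \<comment> \<open>280 e / 256 stays just below the 3 allowed in front of
    \<open>\<delta>\<close>.\<close>
  also have "\<dots> \<le> 3 * exp (- real V / 2)"
    using e_less_272 by (intro mult_right_mono) auto
  also have "\<dots> \<le> 3 * \<delta>" using \<delta> by simp
  finally show ?thesis by (simp add: k_def)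
qed

text \<open>Deterministic core of the selection: \<open>q K\<close> stands for the distance of
  estimator \<open>K\<close> from \<open>s_o\<close>, and \<open>d J K K'\<close> for the difference
  of contrasts averaged over block \<open>J\<close>. A good block \<open>K0\<close> has a small
  criterion, hence so has the minimizer \<open>k\<close>, and the comparison of \<open>k\<close>
  with \<open>K0\<close> then bounds \<open>q k\<close>. The \<open>+ 2\<close> pays for the two
  blocks left out of each median.\<close>

lemma median_selection_bound:
  fixes q :: "nat \<Rightarrow> real" and d :: "nat \<Rightarrow> nat \<Rightarrow> nat \<Rightarrow> real" and med :: "nat \<Rightarrow> nat \<Rightarrow> real"
  assumes few: "2 * card {J\<in>{1..V}. \<not> G J} + 2 < V" and a: "0 \<le> a" and q: "\<And>K. 0 \<le> q K"
    and upper: "\<And>J K K'. \<lbrakk>J \<in> {1..V}; K \<in> {1..V}; K' \<in> {1..V}; G J\<rbrakk> \<Longrightarrow>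
      d J K K' \<le> 3 / 2 * (q K)\<^sup>2 - (q K')\<^sup>2 / 2 + 2 * a * (q K + q K')"
    and lower: "\<And>J K K'. \<lbrakk>J \<in> {1..V}; K \<in> {1..V}; K' \<in> {1..V}; G J\<rbrakk> \<Longrightarrow>
      (q K)\<^sup>2 / 2 - 3 / 2 * (q K')\<^sup>2 - 2 * a * (q K + q K') \<le> d J K K'"
    and good: "\<And>K. K \<in> {1..V} \<Longrightarrow> G K \<Longrightarrow> q K \<le> 2 * a"
    and med: "\<And>K K'. K \<in> {1..V} \<Longrightarrow> K' \<in> {1..V} \<Longrightarrow>
      is_median ({1..V} - {K, K'}) (\<lambda>J. d J K K') (med K K')"
    and argmin: "is_arg_min (\<lambda>K. MAX K'\<in>{1..V}. med K K') (\<lambda>K. K \<in> {1..V}) k"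
  shows "q k \<le> 9 * a"
proof -
  have few': "2 * card {J \<in> {1..V} - {K, K'}. \<not> G J} < card ({1..V} - {K, K'})" for K K'
  proof -
    have "card {J \<in> {1..V} - {K, K'}. \<not> G J} \<le> card {J\<in>{1..V}. \<not> G J}"
      by (intro card_mono) auto
    moreover have "card {1..V} - card {K, K'} \<le> card ({1..V} - {K, K'})"
      by (intro diff_card_le_card_Diff) auto
    moreover have "card {K, K'} \<le> 2" by (simp add: card_insert_if)
    ultimately show ?thesis using few by simp
  qed
  obtain K0 where K0: "K0 \<in> {1..V}" "G K0"
  proof (rule ccontr)
    assume "\<not> thesis"
    then have "{J\<in>{1..V}. \<not> G J} = {1..V}" using that by blast
    then show False using few by simp
  qed
  have k: "k \<in> {1..V}" using argmin by (simp add: is_arg_min_def)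
  have ne: "{1..V} \<noteq> {}" using k by blast
  have "(MAX K'\<in>{1..V}. med K0 K') \<le> 12 * a\<^sup>2"
  proof -
    have "med K0 K' \<le> 12 * a\<^sup>2" if K': "K' \<in> {1..V}" for K'
    proof -
      obtain J where J: "J \<in> {1..V} - {K0, K'}" "G J" "med K0 K' \<le> d J K0 K'"
        using median_ge_witness[OF _ med[OF K0(1) K'] few'] by blast
      have "d J K0 K' \<le> 3 / 2 * (q K0)\<^sup>2 - (q K')\<^sup>2 / 2 + 2 * a * (q K0 + q K')"
        using J K0 K' by (intro upper) auto
      moreover have "q K0 \<le> 2 * a" by (rule good[OF K0])
      moreover from this have "(q K0)\<^sup>2 \<le> (2 * a)\<^sup>2" using q by (intro power_mono)
      moreover have "a * q K0 \<le> a * (2 * a)" using \<open>q K0 \<le> 2 * a\<close> a by (intro mult_left_mono)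
      \<comment> \<open>Removes the uncontrolled \<open>q K'\<close>: the product
        \<open>2 * a * q K'\<close> is at most half the square of \<open>q K'\<close> plus 2 a^2.
        The total is 6 + 4 + 2 = 12 times a^2.\<close>
      moreover have "0 \<le> (q K' - 2 * a)\<^sup>2" by simp
      ultimately show ?thesis using J(3) by (simp add: power2_eq_square algebra_simps)
    qed
    then show ?thesis using ne by simp
  qed
  moreover have "(MAX K'\<in>{1..V}. med k K') \<le> (MAX K'\<in>{1..V}. med K0 K')"
    using argmin K0(1) by (auto simp: is_arg_min_def not_less)
  moreover have "med k K0 \<le> (MAX K'\<in>{1..V}. med k K')" using K0(1) by (intro Max_ge) auto
  moreover obtain J where J: "J \<in> {1..V} - {k, K0}" "G J" "d J k K0 \<le> med k K0"
    using median_le_witness[OF _ med[OF k K0(1)] few'] by blast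
  ultimately have "d J k K0 \<le> 12 * a\<^sup>2" by linarith
  moreover have "(q k)\<^sup>2 / 2 - 3 / 2 * (q K0)\<^sup>2 - 2 * a * (q k + q K0) \<le> d J k K0"
    using J K0 k by (intro lower) auto
  moreover have "(q K0)\<^sup>2 \<le> (2 * a)\<^sup>2" using q good[OF K0] by (intro power_mono)
  moreover have "a * q K0 \<le> a * (2 * a)" using good[OF K0] a by (intro mult_left_mono)
  \<comment> \<open>44 is twice 12 + 6 + 4: the criterion bound, the term in the square of
    \<open>q K0\<close> and the term in \<open>a * q K0\<close>.\<close>
  ultimately have *: "(q k)\<^sup>2 \<le> 4 * a * q k + 44 * a\<^sup>2"
    by (simp add: power2_eq_square algebra_simps)
  show ?thesis
  proof (rule ccontr)
    assume "\<not> ?thesis"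
    \<comment> \<open>Raising 44 to 45 makes the quadratic factor with roots 9a and -5a.\<close>
    then have "0 < (q k - 9 * a) * (q k + 5 * a)" using a by (intro mult_pos_pos) auto
    then have "0 < (q k)\<^sup>2 - 4 * a * q k - 45 * a\<^sup>2" by (simp add: power2_eq_square algebra_simps)
    then show False using * zero_le_power2[of a] by linarith
  qed
qed

section \<open>Tail bounds for empirical means\<close>

text \<open>If at least \<open>k\<close> events occur, then some \<open>k\<close> of them occur
  simultaneously; a union bound over the index sets of size \<open>k\<close> and the product formula
  give the estimate. Positivity of \<open>k\<close> keeps these index sets nonempty.\<close>

lemma (in prob_space) prob_many_events_le:
  assumes "finite I" and E: "\<And>i. i \<in> I \<Longrightarrow> E i \<in> events"
    and indep: "\<And>T. T \<subseteq> I \<Longrightarrow> T \<noteq> {} \<Longrightarrow> prob (\<Inter>i\<in>T. E i) = (\<Prod>i\<in>T. prob (E i))"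
    and p: "\<And>i. i \<in> I \<Longrightarrow> prob (E i) \<le> p" and k: "0 < k"
  shows "prob {\<omega>\<in>space M. k \<le> card {i\<in>I. \<omega> \<in> E i}} \<le> real (card I choose k) * p ^ k"
proof -
  let ?\<T> = "{T. T \<subseteq> I \<and> card T = k}"
  have fin: "finite ?\<T>" using \<open>finite I\<close> by (auto intro: finite_subset[of _ "Pow I"])
  have T: "T \<noteq> {}" "finite T" if "T \<in> ?\<T>" for T
    using that k \<open>finite I\<close> by (auto intro: finite_subset)
  have ev: "(\<Inter>i\<in>T. E i) \<in> events" if "T \<in> ?\<T>" for T
    using T[OF that] that E by (intro sets.finite_INT) auto
  have "{\<omega>\<in>space M. k \<le> card {i\<in>I. \<omega> \<in> E i}} \<subseteq> (\<Union>T\<in>?\<T>. \<Inter>i\<in>T. E i)"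
  proof
    fix \<omega> assume "\<omega> \<in> {\<omega>\<in>space M. k \<le> card {i\<in>I. \<omega> \<in> E i}}"
    then obtain T where "T \<subseteq> {i\<in>I. \<omega> \<in> E i}" "card T = k"
      by (auto elim: obtain_subset_with_card_n)
    then show "\<omega> \<in> (\<Union>T\<in>?\<T>. \<Inter>i\<in>T. E i)" by auto
  qed
  then have "prob {\<omega>\<in>space M. k \<le> card {i\<in>I. \<omega> \<in> E i}} \<le> prob (\<Union>T\<in>?\<T>. \<Inter>i\<in>T. E i)"
    using fin ev by (intro finite_measure_mono) auto
  also have "\<dots> \<le> (\<Sum>T\<in>?\<T>. prob (\<Inter>i\<in>T. E i))"
    using fin ev by (intro finite_measure_subadditive_finite) auto
  also have "\<dots> \<le> (\<Sum>T\<in>?\<T>. p ^ k)"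
  proof (rule sum_mono)
    fix T assume *: "T \<in> ?\<T>"
    then have "prob (\<Inter>i\<in>T. E i) = (\<Prod>i\<in>T. prob (E i))" using T[OF *] by (intro indep) auto
    also have "\<dots> \<le> (\<Prod>i\<in>T. p)" using * by (intro prod_mono) (auto intro: p)
    finally show "prob (\<Inter>i\<in>T. E i) \<le> p ^ k" using * by simp
  qed
  also have "\<dots> = real (card I choose k) * p ^ k"
    using n_subsets[OF \<open>finite I\<close>, of k] by simp
  finally show ?thesis .
qed

text \<open>Markov's inequality for a strict threshold, written without division so that
  \<open>t = 0\<close> is covered: then \<open>W\<close> has mean zero and vanishes almost surely.
  That case arises when \<open>D = 0\<close>.\<close>

lemma (in prob_space) Markov_le:
  assumes int: "integrable M W" and nonneg: "\<And>\<omega>. 0 \<le> W \<omega>"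
    and "0 \<le> t" and le: "expectation W \<le> p * t" and "0 \<le> p"
  shows "prob {\<omega>\<in>space M. t < W \<omega>} \<le> p"
proof (cases "t = 0")
  case True
  then have "expectation W = 0" using le nonneg by (simp add: antisym)
  then have "AE \<omega> in M. W \<omega> = 0" using int nonneg by (simp add: integral_nonneg_eq_0_iff_AE)
  then have "prob {\<omega>\<in>space M. t < W \<omega>} = 0"
    using int True by (intro prob_eq_0_AE) auto
  then show ?thesis using \<open>0 \<le> p\<close> by simp
next
  case False
  then have t: "0 < t" using \<open>0 \<le> t\<close> by simp
  have [measurable]: "W \<in> borel_measurable M" using int by simp
  have "prob {\<omega>\<in>space M. t < W \<omega>} \<le> prob {\<omega>\<in>space M. t \<le> W \<omega>}"
    by (intro finite_measure_mono) auto
  also have "\<dots> \<le> expectation W / t"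
    using int nonneg t by (intro integral_Markov_inequality_measure[where A="{}"]) auto
  also have "\<dots> \<le> p" using le t by (simp add: divide_simps)
  finally show ?thesis .
qed

text \<open>Independence and centring kill the cross terms of the expanded square, leaving
  \<open>card I\<close> diagonal terms of size at most \<open>v\<close> over the square of
  \<open>card I\<close>.\<close>

lemma (in prob_space) second_moment_indep_mean:
  fixes W :: "'i \<Rightarrow> 'a \<Rightarrow> real"
  assumes I: "finite I" "I \<noteq> {}" and indep: "indep_vars (\<lambda>_. borel) W I"
    and int: "\<And>i. i \<in> I \<Longrightarrow> integrable M (W i)" "\<And>i. i \<in> I \<Longrightarrow> integrable M (\<lambda>\<omega>. (W i \<omega>)\<^sup>2)"
    and zero: "\<And>i. i \<in> I \<Longrightarrow> expectation (W i) = 0"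
    and le: "\<And>i. i \<in> I \<Longrightarrow> expectation (\<lambda>\<omega>. (W i \<omega>)\<^sup>2) \<le> v"
  shows "integrable M (\<lambda>\<omega>. ((\<Sum>i\<in>I. W i \<omega>) / card I)\<^sup>2)"
    and "expectation (\<lambda>\<omega>. ((\<Sum>i\<in>I. W i \<omega>) / card I)\<^sup>2) \<le> v / card I"
proof -
  have prod: "integrable M (\<lambda>\<omega>. W i \<omega> * W j \<omega>) \<and>
      expectation (\<lambda>\<omega>. W i \<omega> * W j \<omega>) = (if i = j then expectation (\<lambda>\<omega>. (W i \<omega>)\<^sup>2) else 0)"
    if "i \<in> I" "j \<in> I" for i j
  proof (cases "i = j")
    case True
    then show ?thesis using int that by (simp add: power2_eq_square)
  next
    case False
    have iv: "indep_vars (\<lambda>_. borel) W {i, j}"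
      using that by (intro indep_vars_subset[OF indep]) auto
    have "integrable M (\<lambda>\<omega>. \<Prod>i\<in>{i, j}. W i \<omega>)"
      using int that by (intro indep_vars_integrable[OF _ iv]) auto
    moreover have "expectation (\<lambda>\<omega>. \<Prod>i\<in>{i, j}. W i \<omega>) = (\<Prod>i\<in>{i, j}. expectation (W i))"
      using int that by (intro indep_vars_lebesgue_integral[OF _ iv]) auto
    ultimately show ?thesis using False zero that by simp
  qed
  have eq: "((\<Sum>i\<in>I. W i \<omega>) / card I)\<^sup>2 = (\<Sum>i\<in>I. \<Sum>j\<in>I. W i \<omega> * W j \<omega>) / (card I)\<^sup>2" for \<omega>
    by (simp add: power2_eq_square sum_product)
  show "integrable M (\<lambda>\<omega>. ((\<Sum>i\<in>I. W i \<omega>) / card I)\<^sup>2)"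
    unfolding eq using prod by auto
  have c: "real (card I) > 0" using I by (simp add: card_gt_0_iff)
  have "expectation (\<lambda>\<omega>. ((\<Sum>i\<in>I. W i \<omega>) / card I)\<^sup>2)
      = (\<Sum>i\<in>I. \<Sum>j\<in>I. expectation (\<lambda>\<omega>. W i \<omega> * W j \<omega>)) / (card I)\<^sup>2"
    unfolding eq using prod by (simp add: Bochner_Integration.integral_sum)
  also have "(\<Sum>i\<in>I. \<Sum>j\<in>I. expectation (\<lambda>\<omega>. W i \<omega> * W j \<omega>))
      = (\<Sum>i\<in>I. expectation (\<lambda>\<omega>. (W i \<omega>)\<^sup>2))"
    using prod I by (intro sum.cong) (auto simp: sum.delta)
  also have "\<dots> \<le> real (card I) * v"
    using le by (intro sum_bounded_above) auto
  finally show "expectation (\<lambda>\<omega>. ((\<Sum>i\<in>I. W i \<omega>) / card I)\<^sup>2) \<le> v / card I"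
    using c by (simp add: divide_simps power2_eq_square mult_ac)
qed

text \<open>Each member is dominated by the sum, which is integrable. This turns a bound in
  \<open>ennreal\<close>, as obtained from the envelope, into integrability and a real
  bound.\<close>

lemma integrable_family_of_nn_integral_le:
  fixes f :: "'i \<Rightarrow> 'a \<Rightarrow> real"
  assumes fin: "finite I" and meas: "\<And>i. i \<in> I \<Longrightarrow> f i \<in> borel_measurable M"
    and nonneg: "\<And>i x. i \<in> I \<Longrightarrow> 0 \<le> f i x"
    and le: "(\<integral>\<^sup>+x. ennreal (\<Sum>i\<in>I. f i x) \<partial>M) \<le> ennreal C" and "0 \<le> C"
  shows "i \<in> I \<Longrightarrow> integrable M (f i)" and "(\<Sum>i\<in>I. \<integral>x. f i x \<partial>M) \<le> C"
proof -
  have "integrable M (\<lambda>x. \<Sum>i\<in>I. f i x)"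
    using le nonneg meas by (intro integrableI_nonneg) (auto intro!: sum_nonneg simp: le_less_trans)
  then show int: "integrable M (f i)" if "i \<in> I" for i
    using that meas[OF that] nonneg fin
    by (elim Bochner_Integration.integrable_bound)
       (auto intro!: AE_I2 member_le_sum simp: sum_nonneg)
  have "ennreal (\<integral>x. (\<Sum>i\<in>I. f i x) \<partial>M) \<le> ennreal C"
    using le int nonneg by (subst nn_integral_eq_integral[symmetric]) (auto intro!: sum_nonneg)
  then show "(\<Sum>i\<in>I. \<integral>x. f i x \<partial>M) \<le> C"
    using int \<open>0 \<le> C\<close> by (simp add: ennreal_le_iff)
qed

text \<open>Markov's inequality for the sum of squared empirical means. The size of \<open>J\<close>
  enters only through the total second moment \<open>C\<close>, which the envelope controls.\<close>

lemma (in prob_space) emp_mean_family_tail: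
  fixes f :: "'j \<Rightarrow> 'z \<Rightarrow> real"
  assumes I: "finite I" "I \<noteq> {}" and J: "finite J" and indep: "indep_vars (\<lambda>_. N) Z I"
    and ident: "\<And>i. i \<in> I \<Longrightarrow> distr M N (Z i) = \<mu>"
    and f: "\<And>j. j \<in> J \<Longrightarrow> integrable \<mu> (f j)" "\<And>j. j \<in> J \<Longrightarrow> integrable \<mu> (\<lambda>z. (f j z)\<^sup>2)"
      "\<And>j. j \<in> J \<Longrightarrow> (\<integral>z. f j z \<partial>\<mu>) = 0"
    and C: "(\<Sum>j\<in>J. \<integral>z. (f j z)\<^sup>2 \<partial>\<mu>) \<le> C" and "0 \<le> t" "0 \<le> p" "C / card I \<le> p * t"
  shows "prob {\<omega>\<in>space M. t < (\<Sum>j\<in>J. (emp_mean I (\<lambda>i. Z i \<omega>) (f j))\<^sup>2)} \<le> p"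
proof -
  have Z: "Z i \<in> measurable M N" if "i \<in> I" for i
    using indep that by (auto simp: indep_vars_def)
  obtain i0 where "i0 \<in> I" using I by blast
  then have "sets \<mu> = sets N" using ident[of i0] by auto
  then have f_meas: "f j \<in> borel_measurable N" if "j \<in> J" for j
    using borel_measurable_integrable[OF f(1)[OF that]] by (simp cong: measurable_cong_sets)
  have 1: "integrable M (\<lambda>\<omega>. f j (Z i \<omega>))" "integrable M (\<lambda>\<omega>. (f j (Z i \<omega>))\<^sup>2)"
      "expectation (\<lambda>\<omega>. f j (Z i \<omega>)) = 0"
      "expectation (\<lambda>\<omega>. (f j (Z i \<omega>))\<^sup>2) = (\<integral>z. (f j z)\<^sup>2 \<partial>\<mu>)" if "i \<in> I" "j \<in> J" for i j
    using f[OF that(2)] f_meas[OF that(2)] Z[OF that(1)] unfolding ident[OF that(1), symmetric]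
    by (auto simp: integrable_distr_eq integral_distr)
  have 2: "integrable M (\<lambda>\<omega>. (emp_mean I (\<lambda>i. Z i \<omega>) (f j))\<^sup>2)"
    "expectation (\<lambda>\<omega>. (emp_mean I (\<lambda>i. Z i \<omega>) (f j))\<^sup>2) \<le> (\<integral>z. (f j z)\<^sup>2 \<partial>\<mu>) / card I"
    if j: "j \<in> J" for j
    unfolding emp_mean_def
    using I indep_vars_compose2[OF indep, of "\<lambda>_. f j" "\<lambda>_. borel"] f_meas[OF j] 1 j
    by (auto intro!: second_moment_indep_mean)
  show ?thesis
  proof (rule Markov_le)
    show "integrable M (\<lambda>\<omega>. \<Sum>j\<in>J. (emp_mean I (\<lambda>i. Z i \<omega>) (f j))\<^sup>2)" using 2 by auto
    have "expectation (\<lambda>\<omega>. \<Sum>j\<in>J. (emp_mean I (\<lambda>i. Z i \<omega>) (f j))\<^sup>2)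
        = (\<Sum>j\<in>J. expectation (\<lambda>\<omega>. (emp_mean I (\<lambda>i. Z i \<omega>) (f j))\<^sup>2))"
      using 2 by simp
    also have "\<dots> \<le> (\<Sum>j\<in>J. (\<integral>z. (f j z)\<^sup>2 \<partial>\<mu>) / card I)" by (intro sum_mono 2)
    also have "\<dots> \<le> C / card I"
      using C by (simp add: divide_right_mono flip: sum_divide_distrib)
    finally show "expectation (\<lambda>\<omega>. \<Sum>j\<in>J. (emp_mean I (\<lambda>i. Z i \<omega>) (f j))\<^sup>2) \<le> p * t"
      using assms by linarith
  qed (use assms in \<open>auto intro: sum_nonneg\<close>)
qed

section \<open>Orthonormal families and the envelope\<close>

lemma L2_space_mult_integrable:
  assumes "f \<in> L2_space P" "g \<in> L2_space P"
  shows "integrable P (\<lambda>x. f x * g x)"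
proof (rule Bochner_Integration.integrable_bound)
  show "integrable P (\<lambda>x. (f x)\<^sup>2 + (g x)\<^sup>2)"
    using assms by (auto simp: L2_space_def)
  show "(\<lambda>x. f x * g x) \<in> borel_measurable P"
    using assms by (auto simp: L2_space_def)
  have "\<bar>a * b\<bar> \<le> a\<^sup>2 + b\<^sup>2" for a b :: real
  proof -
    have "2 * \<bar>a * b\<bar> \<le> a\<^sup>2 + b\<^sup>2"
      using sum_squares_bound[of "\<bar>a\<bar>" "\<bar>b\<bar>"] by (simp add: abs_mult mult.assoc)
    then show ?thesis using abs_ge_zero[of "a * b"] by linarith
  qed
  then show "AE x in P. norm (f x * g x) \<le> norm ((f x)\<^sup>2 + (g x)\<^sup>2)"
    by (auto simp del: abs_mult)
qed

lemma L2_space_add: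
  assumes "f \<in> L2_space P" "g \<in> L2_space P"
  shows "(\<lambda>x. f x + g x) \<in> L2_space P"
  using assms L2_space_mult_integrable[OF assms]
  by (auto simp: L2_space_def power2_sum mult.assoc)

lemma L2_space_diff:
  assumes "f \<in> L2_space P" "g \<in> L2_space P"
  shows "(\<lambda>x. f x - g x) \<in> L2_space P"
  using assms L2_space_mult_integrable[OF assms]
  by (auto simp: L2_space_def power2_diff mult.assoc)

lemma linear_space_scale: "linear_space S \<Longrightarrow> f \<in> S \<Longrightarrow> (\<lambda>x. c * f x) \<in> S"
  by (simp add: linear_space_def)

lemma linear_space_add: "linear_space S \<Longrightarrow> f \<in> S \<Longrightarrow> g \<in> S \<Longrightarrow> (\<lambda>x. f x + g x) \<in> S"
  by (simp add: linear_space_def)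

lemma linear_space_diff:
  assumes "linear_space S" "f \<in> S" "g \<in> S"
  shows "(\<lambda>x. f x - g x) \<in> S"
  using linear_space_add[OF assms(1,2) linear_space_scale[OF assms(1,3), of "- 1"]] by simp

lemma linear_space_sum:
  assumes "linear_space S" "\<And>i. i \<in> I \<Longrightarrow> f i \<in> S"
  shows "(\<lambda>x. \<Sum>i\<in>I. c i * f i x) \<in> S"
  using assms(2)
proof (induction I rule: infinite_finite_induct)
  case (insert i I)
  then show ?case using assms(1) by (auto simp: linear_space_def)
qed (use assms(1) in \<open>auto simp: linear_space_def\<close>)

text \<open>Indexing by an initial segment of the naturals lets a family be lengthened by one
  function at a time; completeness is a separate property.\<close>

definition orthonormal_in :: "'a measure \<Rightarrow> ('a \<Rightarrow> real) set \<Rightarrow> nat \<Rightarrow> (nat \<Rightarrow> 'a \<Rightarrow> real) \<Rightarrow> bool" where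
  "orthonormal_in P S m \<psi> \<longleftrightarrow> (\<forall>i<m. \<psi> i \<in> S) \<and>
     (\<forall>i<m. \<forall>j<m. (\<integral>x. \<psi> i x * \<psi> j x \<partial>P) = of_bool (i = j))"

context
  fixes P :: "'a measure" and S :: "('a \<Rightarrow> real) set"
  assumes S: "S \<subseteq> L2_space P" "linear_space S"
begin

lemma orthonormal_integral_mult:
  assumes "orthonormal_in P S m \<psi>" "j < m"
  shows "(\<integral>x. (\<Sum>i<m. c i * \<psi> i x) * \<psi> j x \<partial>P) = c j"
proof -
  have [simp]: "integrable P (\<lambda>x. \<psi> i x * \<psi> j x)" if "i < m" for i
    using assms that S by (intro L2_space_mult_integrable) (auto simp: orthonormal_in_def)
  have "(\<integral>x. (\<Sum>i<m. c i * \<psi> i x) * \<psi> j x \<partial>P) = (\<integral>x. (\<Sum>i<m. c i * (\<psi> i x * \<psi> j x)) \<partial>P)"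
    by (simp add: sum_distrib_right mult.assoc)
  also have "\<dots> = (\<Sum>i<m. c i * (\<integral>x. \<psi> i x * \<psi> j x \<partial>P))"
    by simp
  also have "\<dots> = (\<Sum>i<m. if i = j then c i else 0)"
    using assms by (intro sum.cong) (auto simp: orthonormal_in_def)
  finally show ?thesis using assms(2) by simp
qed

lemma orthonormal_integral_square:
  assumes "orthonormal_in P S m \<psi>"
  shows "(\<integral>x. (\<Sum>i<m. c i * \<psi> i x)\<^sup>2 \<partial>P) = (\<Sum>i<m. (c i)\<^sup>2)"
proof -
  have "(\<lambda>x. \<Sum>i<m. c i * \<psi> i x) \<in> S"
    using assms by (intro linear_space_sum S) (auto simp: orthonormal_in_def)
  then have [simp]: "integrable P (\<lambda>x. (\<Sum>i<m. c i * \<psi> i x) * \<psi> j x)" if "j < m" for j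
    using assms that S by (intro L2_space_mult_integrable) (auto simp: orthonormal_in_def)
  have "(\<integral>x. (\<Sum>i<m. c i * \<psi> i x)\<^sup>2 \<partial>P)
      = (\<integral>x. (\<Sum>j<m. c j * ((\<Sum>i<m. c i * \<psi> i x) * \<psi> j x)) \<partial>P)"
    by (simp add: power2_eq_square sum_distrib_left mult_ac)
  also have "\<dots> = (\<Sum>j<m. c j * (\<integral>x. (\<Sum>i<m. c i * \<psi> i x) * \<psi> j x \<partial>P))"
    by simp
  also have "\<dots> = (\<Sum>j<m. (c j)\<^sup>2)"
    using orthonormal_integral_mult[OF assms] by (simp add: power2_eq_square)
  finally show ?thesis .
qed

text \<open>The equality case of the Cauchy-Schwarz inequality: the combination with coefficients
  proportional to \<open>\<psi> i x\<close>, normalized to norm one, has the sum as its squared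
  value at \<open>x\<close>.\<close>

lemma orthonormal_sum_squares_le_Psi:
  assumes "orthonormal_in P S m \<psi>"
  shows "ennreal (\<Sum>i<m. (\<psi> i x)\<^sup>2) \<le> Psi P S x"
proof (cases "(\<Sum>i<m. (\<psi> i x)\<^sup>2) = 0")
  case False
  define s where "s = (\<Sum>i<m. (\<psi> i x)\<^sup>2)"
  have s: "0 < s" using False by (simp add: s_def order_less_le sum_nonneg)
  define t where "t = (\<lambda>z. \<Sum>i<m. \<psi> i x / sqrt s * \<psi> i z)"
  have "t \<in> S"
    unfolding t_def using assms by (intro linear_space_sum S) (auto simp: orthonormal_in_def)
  moreover have "L2_norm P t = 1"
    unfolding L2_norm_def t_def orthonormal_integral_square[OF assms]
    using s by (simp add: power_divide flip: sum_divide_distrib s_def)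
  moreover have "(t x)\<^sup>2 = s"
  proof -
    have "t x = s / sqrt s"
      unfolding t_def s_def by (simp add: power2_eq_square sum_divide_distrib)
    then show ?thesis using s by (simp add: real_div_sqrt)
  qed
  ultimately show ?thesis
    unfolding Psi_def s_def[symmetric] by (intro SUP_upper2[of t]) auto
qed simp

text \<open>All multiples of a null function lie in the unit ball, so a nonzero value at
  \<open>x\<close> would make the supremum at \<open>x\<close> infinite. This turns almost
  everywhere identities into identities at points.\<close>

lemma null_fun_zero_of_Psi_finite:
  assumes "u \<in> S" "(\<integral>x. (u x)\<^sup>2 \<partial>P) = 0" "Psi P S x < \<infinity>"
  shows "u x = 0"
proof (rule ccontr)
  assume nz: "u x \<noteq> 0"
  obtain p where p: "Psi P S x = ennreal p" "0 \<le> p"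
    using assms(3) by (cases "Psi P S x") auto
  \<comment> \<open>Scaled so that the squared value at \<open>x\<close> is \<open>p + 1\<close>,
    above the supposed supremum \<open>p\<close>.\<close>
  define c where "c = sqrt (p + 1) / u x"
  have "(\<lambda>z. c * u z) \<in> S" "L2_norm P (\<lambda>z. c * u z) = 0"
    using assms S by (auto simp: L2_norm_def power_mult_distrib linear_space_def)
  then have "ennreal ((c * u x)\<^sup>2) \<le> Psi P S x"
    unfolding Psi_def by (intro SUP_upper2[of "\<lambda>z. c * u z"]) auto
  also have "(c * u x)\<^sup>2 = p + 1" using nz p by (simp add: c_def)
  finally show False using p by simp
qed

text \<open>One Gram-Schmidt step: normalize \<open>u\<close> and append it.\<close>

lemma orthonormal_extend:
  assumes on: "orthonormal_in P S m \<psi>" and u: "u \<in> S"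
    and orth: "\<And>j. j < m \<Longrightarrow> (\<integral>x. u x * \<psi> j x \<partial>P) = 0" and nz: "(\<integral>x. (u x)\<^sup>2 \<partial>P) \<noteq> 0"
  shows "\<exists>\<phi>. orthonormal_in P S (Suc m) \<phi>"
proof -
  define s where "s = (\<integral>x. (u x)\<^sup>2 \<partial>P)"
  have s: "0 < s" using nz by (simp add: s_def order_less_le)
  define \<phi> where "\<phi> = \<psi>(m := (\<lambda>x. (1 / sqrt s) * u x))"
  have "(\<integral>x. \<phi> i x * \<phi> j x \<partial>P) = of_bool (i = j)" if "i < Suc m" "j < Suc m" for i j
  proof -
    have eq: "(\<integral>x. u x * u x \<partial>P) = s" by (simp add: s_def power2_eq_square)
    consider "i < m" "j < m" | "i < m" "j = m" | "i = m" "j < m" | "i = m" "j = m"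
      using \<open>i < Suc m\<close> \<open>j < Suc m\<close> by (auto simp: less_Suc_eq)
    then show ?thesis
    proof cases
      case 1 then show ?thesis using on by (simp add: \<phi>_def orthonormal_in_def)
    next
      case 2 then show ?thesis using orth[of i] by (simp add: \<phi>_def mult.commute)
    next
      case 3 then show ?thesis using orth[of j] by (simp add: \<phi>_def)
    next
      case 4 then show ?thesis using s by (simp add: \<phi>_def eq)
    qed
  qed
  moreover have "\<phi> i \<in> S" if "i < Suc m" for i
    using that on linear_space_scale[OF S(2) u, of "1 / sqrt s"] by (auto simp: \<phi>_def orthonormal_in_def less_Suc_eq)
  ultimately show ?thesis unfolding orthonormal_in_def by blast
qed

text \<open>Integrating the sum of squares against \<open>Psi\<close> bounds the length of every
  orthonormal family, so one of maximal length exists. The remainder of \<open>u\<close> after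
  projection is orthogonal to it, hence null by maximality, hence zero wherever \<open>Psi\<close>
  is finite. A pointwise expansion is what empirical means require.\<close>

lemma orthonormal_basis_exists:
  assumes fin: "(\<integral>\<^sup>+x. Psi P S x \<partial>P) < \<infinity>"
  obtains m \<psi> where "orthonormal_in P S m \<psi>"
    "\<And>u x. u \<in> S \<Longrightarrow> Psi P S x < \<infinity> \<Longrightarrow> u x = (\<Sum>i<m. (\<integral>z. u z * \<psi> i z \<partial>P) * \<psi> i x)"
proof -
  let ?Q = "\<lambda>m. \<exists>\<psi>. orthonormal_in P S m \<psi>"
  obtain C where C: "(\<integral>\<^sup>+x. Psi P S x \<partial>P) = ennreal C" "0 \<le> C"
    using fin by (cases "\<integral>\<^sup>+x. Psi P S x \<partial>P") auto
  have bound: "m \<le> nat \<lceil>C\<rceil>" if on: "orthonormal_in P S m \<psi>" for m \<psi>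
  proof -
    have [simp]: "integrable P (\<lambda>x. (\<psi> i x)\<^sup>2)" if "i < m" for i
      using that on S by (auto simp: orthonormal_in_def L2_space_def)
    have "(\<integral>x. (\<Sum>i<m. (\<psi> i x)\<^sup>2) \<partial>P) = (\<Sum>i<m. (\<integral>x. (\<psi> i x)\<^sup>2 \<partial>P))"
      by (intro Bochner_Integration.integral_sum) simp
    also have "\<dots> = (\<Sum>i<m. 1)"
      using on by (intro sum.cong) (auto simp: orthonormal_in_def power2_eq_square)
    finally have "ennreal m = (\<integral>\<^sup>+x. ennreal (\<Sum>i<m. (\<psi> i x)\<^sup>2) \<partial>P)"
      by (subst nn_integral_eq_integral) (auto intro!: sum_nonneg)
    also have "\<dots> \<le> ennreal C"
      unfolding C(1)[symmetric] using orthonormal_sum_squares_le_Psi[OF on]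
      by (intro nn_integral_mono)
    finally have "real m \<le> C" using C(2) by (simp add: ennreal_le_iff)
    then show ?thesis by linarith
  qed
  have "?Q 0" by (simp add: orthonormal_in_def)
  then obtain m where m: "?Q m" "\<And>k. ?Q k \<Longrightarrow> k \<le> m"
    using Nat.ex_has_greatest_nat[of ?Q 0 "nat \<lceil>C\<rceil>"] bound by blast
  then obtain \<psi> where on: "orthonormal_in P S m \<psi>" by blast
  have "u x = (\<Sum>i<m. (\<integral>z. u z * \<psi> i z \<partial>P) * \<psi> i x)" if u: "u \<in> S" and fx: "Psi P S x < \<infinity>" for u x
  proof -
    let ?v = "\<lambda>x. \<Sum>i<m. (\<integral>z. u z * \<psi> i z \<partial>P) * \<psi> i x"
    let ?w = "\<lambda>x. u x - ?v x"
    have v: "?v \<in> S"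
      using on by (intro linear_space_sum S) (auto simp: orthonormal_in_def)
    have w: "?w \<in> S" by (intro linear_space_diff S u v)
    have "(\<integral>x. ?w x * \<psi> j x \<partial>P) = 0" if "j < m" for j
    proof -
      have "\<psi> j \<in> L2_space P" using on that S by (auto simp: orthonormal_in_def)
      then have "(\<integral>x. u x * \<psi> j x - ?v x * \<psi> j x \<partial>P) = 0"
        using u v S orthonormal_integral_mult[OF on that, of "\<lambda>i. \<integral>z. u z * \<psi> i z \<partial>P"]
        by (subst Bochner_Integration.integral_diff) (auto intro: L2_space_mult_integrable)
      then show ?thesis by (simp add: left_diff_distrib)
    qed
    then have "(\<integral>x. (?w x)\<^sup>2 \<partial>P) = 0"
      using orthonormal_extend[OF on w] m(2)[of "Suc m"] by auto
    from null_fun_zero_of_Psi_finite[OF w this fx] show ?thesis by simp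
  qed
  with on show ?thesis by (rule that)
qed

lemma integral_square_basis:
  assumes on: "orthonormal_in P S m \<psi>" and u: "u \<in> S" and fin: "AE x in P. Psi P S x < \<infinity>"
    and basis: "\<And>u x. u \<in> S \<Longrightarrow> Psi P S x < \<infinity> \<Longrightarrow> u x = (\<Sum>i<m. (\<integral>z. u z * \<psi> i z \<partial>P) * \<psi> i x)"
  shows "(\<integral>x. (u x)\<^sup>2 \<partial>P) = (\<Sum>i<m. (\<integral>z. u z * \<psi> i z \<partial>P)\<^sup>2)"
proof -
  have [measurable]: "\<psi> i \<in> borel_measurable P" if "i < m" for i
    using on S that by (auto simp: orthonormal_in_def L2_space_def)
  have [measurable]: "u \<in> borel_measurable P" using u S by (auto simp: L2_space_def)
  have "(\<integral>x. (u x)\<^sup>2 \<partial>P) = (\<integral>x. (\<Sum>i<m. (\<integral>z. u z * \<psi> i z \<partial>P) * \<psi> i x)\<^sup>2 \<partial>P)"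
  proof (rule integral_cong_AE)
    show "AE x in P. (u x)\<^sup>2 = (\<Sum>i<m. (\<integral>z. u z * \<psi> i z \<partial>P) * \<psi> i x)\<^sup>2"
      using fin by eventually_elim (simp flip: basis[OF u])
  qed auto
  then show ?thesis by (simp add: orthonormal_integral_square[OF on])
qed

end

section \<open>Least squares on a block\<close>

lemma linear_form_abs_le:
  fixes b c :: "'i \<Rightarrow> real"
  shows "\<bar>\<Sum>i\<in>I. c i * b i\<bar> \<le> sqrt (\<Sum>i\<in>I. (c i)\<^sup>2) * sqrt (\<Sum>i\<in>I. (b i)\<^sup>2)"
  using real_sqrt_le_mono[OF Cauchy_Schwarz_ineq_sum[of c b I]] by (simp add: real_sqrt_mult)

text \<open>Cauchy-Schwarz over pairs of indices; the last factor is the Frobenius norm of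
  \<open>A\<close>.\<close>

lemma quadratic_form_abs_le:
  fixes A :: "'i \<Rightarrow> 'i \<Rightarrow> real"
  shows "\<bar>\<Sum>i\<in>I. \<Sum>j\<in>I. c i * c j * A i j\<bar>
    \<le> (\<Sum>i\<in>I. (c i)\<^sup>2) * sqrt (\<Sum>i\<in>I. \<Sum>j\<in>I. (A i j)\<^sup>2)"
proof -
  have "(\<Sum>i\<in>I. \<Sum>j\<in>I. (c i * c j)\<^sup>2) = (\<Sum>i\<in>I. (c i)\<^sup>2)\<^sup>2"
    by (simp add: power2_eq_square sum_product mult_ac)
  then show ?thesis
    using linear_form_abs_le[of "\<lambda>(i, j). c i * c j" "\<lambda>(i, j). A i j" "I \<times> I"]
    by (simp add: sum.cartesian_product case_prod_unfold sum_nonneg)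
qed

text \<open>The difference is the quadratic form of the empirical Gram matrix minus the identity,
  evaluated at \<open>c\<close>. The hypothesis \<open>Q\<close> bounds its Frobenius norm by 1/2
  and does not involve \<open>c\<close>, so the conclusion is uniform in \<open>u\<close>.\<close>

lemma emp_mean_square_close:
  fixes \<psi> :: "nat \<Rightarrow> 'a \<Rightarrow> real"
  assumes I: "finite I" "I \<noteq> {}"
    and u: "\<And>i. i \<in> I \<Longrightarrow> u (fst (z i)) = (\<Sum>j<m. c j * \<psi> j (fst (z i)))"
    and Q: "(\<Sum>j<m. \<Sum>k<m. (emp_mean I z (\<lambda>(x, y). \<psi> j x * \<psi> k x - of_bool (j = k)))\<^sup>2) \<le> 1 / 4"
  shows "\<bar>emp_mean I z (\<lambda>(x, y). (u x)\<^sup>2) - (\<Sum>j<m. (c j)\<^sup>2)\<bar> \<le> (\<Sum>j<m. (c j)\<^sup>2) / 2"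
proof -
  let ?A = "\<lambda>j k. emp_mean I z (\<lambda>(x, y). \<psi> j x * \<psi> k x - of_bool (j = k))"
  have N: "real (card I) > 0" using I by (simp add: card_gt_0_iff)
  have A: "?A j k = (\<Sum>i\<in>I. \<psi> j (fst (z i)) * \<psi> k (fst (z i))) / card I - of_bool (j = k)" for j k
    using N by (simp add: emp_mean_def case_prod_unfold sum_subtractf diff_divide_distrib)
  have "(\<Sum>j<m. \<Sum>k<m. c j * c k * ?A j k)
      = (\<Sum>j<m. \<Sum>k<m. \<Sum>i\<in>I. c j * \<psi> j (fst (z i)) * (c k * \<psi> k (fst (z i))) / card I)
        - (\<Sum>j<m. \<Sum>k<m. c j * c k * of_bool (j = k))"
    unfolding A
    by (simp add: sum_subtractf right_diff_distrib sum_divide_distrib sum_distrib_left mult_ac)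
  also have "(\<Sum>j<m. \<Sum>k<m. c j * c k * of_bool (j = k)) = (\<Sum>j<m. (c j)\<^sup>2)"
    by (simp add: power2_eq_square of_bool_def if_distrib cong: if_cong)
  also have "(\<Sum>j<m. \<Sum>k<m. \<Sum>i\<in>I. c j * \<psi> j (fst (z i)) * (c k * \<psi> k (fst (z i))) / card I)
      = (\<Sum>i\<in>I. \<Sum>j<m. \<Sum>k<m. c j * \<psi> j (fst (z i)) * (c k * \<psi> k (fst (z i))) / card I)"
    \<comment> \<open>Two exchanges of summation bring the sample index outermost.\<close>
    by (subst (2) sum.swap, subst sum.swap, rule refl)
  also have "\<dots> = emp_mean I z (\<lambda>(x, y). (u x)\<^sup>2)"
    using u by (simp add: emp_mean_def case_prod_unfold power2_eq_square sum_product
        flip: sum_divide_distrib)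
  finally have "\<bar>emp_mean I z (\<lambda>(x, y). (u x)\<^sup>2) - (\<Sum>j<m. (c j)\<^sup>2)\<bar>
      \<le> (\<Sum>j<m. (c j)\<^sup>2) * sqrt (\<Sum>j<m. \<Sum>k<m. (?A j k)\<^sup>2)"
    using quadratic_form_abs_le[of c ?A "{..<m}"] by simp
  also have "\<dots> \<le> (\<Sum>j<m. (c j)\<^sup>2) * (1 / 2)"
    using Q by (intro mult_left_mono real_le_lsqrt) (auto simp: power2_eq_square intro!: sum_nonneg)
  finally show ?thesis by simp
qed

text \<open>The empirical mean is linear in \<open>c\<close>, so Cauchy-Schwarz separates
  \<open>c\<close> from the vector of residual means, whose norm is at most \<open>a\<close> by
  \<open>W\<close>.\<close>

lemma emp_mean_linear_le:
  fixes \<psi> :: "nat \<Rightarrow> 'a \<Rightarrow> real"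
  assumes u: "\<And>i. i \<in> I \<Longrightarrow> u (fst (z i)) = (\<Sum>j<m. c j * \<psi> j (fst (z i)))"
    and W: "(\<Sum>j<m. (emp_mean I z (\<lambda>(x, y). (y - s x) * \<psi> j x))\<^sup>2) \<le> a\<^sup>2" and "0 \<le> a"
  shows "\<bar>emp_mean I z (\<lambda>(x, y). (y - s x) * u x)\<bar> \<le> a * sqrt (\<Sum>j<m. (c j)\<^sup>2)"
proof -
  let ?b = "\<lambda>j. emp_mean I z (\<lambda>(x, y). (y - s x) * \<psi> j x)"
  have "(\<Sum>j<m. c j * ?b j)
      = (\<Sum>j<m. \<Sum>i\<in>I. (snd (z i) - s (fst (z i))) * (c j * \<psi> j (fst (z i))) / card I)"
    by (simp add: emp_mean_def case_prod_unfold sum_divide_distrib sum_distrib_left mult_ac)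
  also have "\<dots> = emp_mean I z (\<lambda>(x, y). (y - s x) * u x)"
    by (subst sum.swap) (simp add: emp_mean_def case_prod_unfold u sum_distrib_left
        flip: sum_divide_distrib)
  finally have "\<bar>emp_mean I z (\<lambda>(x, y). (y - s x) * u x)\<bar>
      \<le> sqrt (\<Sum>j<m. (c j)\<^sup>2) * sqrt (\<Sum>j<m. (?b j)\<^sup>2)"
    using linear_form_abs_le[of c ?b "{..<m}"] by simp
  also have "\<dots> \<le> sqrt (\<Sum>j<m. (c j)\<^sup>2) * a"
    using W \<open>0 \<le> a\<close> by (intro mult_left_mono real_le_lsqrt) (auto intro!: sum_nonneg)
  finally show ?thesis by (simp only: mult.commute)
qed

text \<open>Expanding both contrasts around \<open>s\<close>, the squared residuals
  \<open>y - s x\<close> cancel. What remains are the two kinds of averages that a good block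
  controls.\<close>

lemma emp_mean_contrast_diff:
  "emp_mean I z (\<lambda>p. contrast t p - contrast t' p)
    = emp_mean I z (\<lambda>(x, y). (t x - s x)\<^sup>2) - emp_mean I z (\<lambda>(x, y). (t' x - s x)\<^sup>2)
      - 2 * (emp_mean I z (\<lambda>(x, y). (y - s x) * (t x - s x))
             - emp_mean I z (\<lambda>(x, y). (y - s x) * (t' x - s x)))"
proof -
  have diff: "contrast t p - contrast t' p
      = (case p of (x, y) \<Rightarrow> (t x - s x)\<^sup>2) - (case p of (x, y) \<Rightarrow> (t' x - s x)\<^sup>2)
        - 2 * ((case p of (x, y) \<Rightarrow> (y - s x) * (t x - s x))
               - (case p of (x, y) \<Rightarrow> (y - s x) * (t' x - s x)))" for p
    by (cases p) (simp add: contrast_def power2_eq_square algebra_simps)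
  have "emp_mean I z (\<lambda>p. f p - f' p - 2 * (g p - g' p))
      = emp_mean I z f - emp_mean I z f' - 2 * (emp_mean I z g - emp_mean I z g')"
    for f f' g g' :: "'a \<times> real \<Rightarrow> real"
    by (simp add: emp_mean_def sum_subtractf diff_divide_distrib right_diff_distrib sum_distrib_left)
  then show ?thesis unfolding diff .
qed

lemma quadratic_gap_bounds:
  fixes s s' l l' x x' p p' :: real
  assumes "\<bar>s - x\<bar> \<le> x / 2" "\<bar>s' - x'\<bar> \<le> x' / 2" "\<bar>l\<bar> \<le> p" "\<bar>l'\<bar> \<le> p'"
  shows "s - s' - 2 * (l - l') \<le> 3 / 2 * x - x' / 2 + 2 * (p + p')"
    and "x / 2 - 3 / 2 * x' - 2 * (p + p') \<le> s - s' - 2 * (l - l')"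
proof -
  note b = assms[THEN abs_le_D1] assms[THEN abs_le_D2]
  show "s - s' - 2 * (l - l') \<le> 3 / 2 * x - x' / 2 + 2 * (p + p')"
    using b(1,4,6,7) by argo
  show "x / 2 - 3 / 2 * x' - 2 * (p + p') \<le> s - s' - 2 * (l - l')"
    using b(2,3,5,8) by argo
qed

text \<open>A parabola with its minimum at 1 has its vertex there; testing with \<open>B / A\<close>
  avoids derivatives. If \<open>A = 0\<close>, the function is linear and a minimum forces
  \<open>B = 0\<close>.\<close>

lemma real_quadratic_min_at_one:
  fixes A B :: real
  assumes "\<And>l. A - 2 * B \<le> l\<^sup>2 * A - 2 * l * B" "0 \<le> A"
  shows "A = B"
proof (cases "A = 0")
  case True
  then show ?thesis using assms(1)[of 0] assms(1)[of 2] by simp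
next
  case False
  then have "(B / A)\<^sup>2 * A - 2 * (B / A) * B = - (B\<^sup>2 / A)"
    by (simp add: power2_eq_square field_simps)
  then have "A - 2 * B + B\<^sup>2 / A \<le> 0" using assms(1)[of "B / A"] by simp
  moreover have "A - 2 * B + B\<^sup>2 / A = (A - B)\<^sup>2 / A"
    using False by (simp add: power2_eq_square field_simps)
  ultimately have "(A - B)\<^sup>2 \<le> 0"
    using False assms(2) by (simp add: divide_le_0_iff)
  then show ?thesis by simp
qed

text \<open>On the line through \<open>s\<close> and \<open>t\<close> the empirical risk is a
  parabola in the parameter \<open>l\<close>, minimal at \<open>l = 1\<close>, where the line meets
  \<open>t\<close>.\<close>

lemma arg_min_normal_equation:
  assumes S: "linear_space S" "s \<in> S"
    and min: "is_arg_min (\<lambda>t. emp_mean I z (contrast t)) (\<lambda>t. t \<in> S) t"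
  shows "emp_mean I z (\<lambda>(x, y). (t x - s x)\<^sup>2) = emp_mean I z (\<lambda>(x, y). (y - s x) * (t x - s x))"
    (is "?A = ?B")
proof (rule real_quadratic_min_at_one)
  fix l :: real
  define t' where "t' = (\<lambda>x. s x + l * (t x - s x))"
  have "t \<in> S" using min by (simp add: is_arg_min_def)
  then have "t' \<in> S"
    unfolding t'_def by (intro linear_space_add linear_space_scale linear_space_diff S)
  then have "emp_mean I z (contrast t) \<le> emp_mean I z (contrast t')"
    using min by (auto simp: is_arg_min_def not_less)
  then have "emp_mean I z (\<lambda>p. contrast t p - contrast t' p) \<le> 0"
    by (simp add: emp_mean_def sum_subtractf diff_divide_distrib)
  moreover have "emp_mean I z (\<lambda>(x, y). (t' x - s x)\<^sup>2) = l\<^sup>2 * ?A"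
    by (simp add: emp_mean_def t'_def case_prod_unfold power_mult_distrib sum_distrib_left)
  moreover have "emp_mean I z (\<lambda>(x, y). (y - s x) * (t' x - s x)) = l * ?B"
    by (simp add: emp_mean_def t'_def case_prod_unfold sum_distrib_left mult_ac)
  ultimately show "?A - 2 * ?B \<le> l\<^sup>2 * ?A - 2 * l * ?B"
    unfolding emp_mean_contrast_diff[of I z t t' s] by (simp add: algebra_simps)
qed (simp add: emp_mean_def case_prod_unfold sum_nonneg)

section \<open>The regression model\<close>

lemma (in prob_space) subalgebra_vimage:
  assumes "X \<in> measurable M N"
  shows "sigma_finite_subalgebra M (vimage_algebra (space M) X N)"
    and "X \<in> measurable (vimage_algebra (space M) X N) N"
proof -
  have X: "X \<in> space M \<rightarrow> space N" using assms by (auto dest: measurable_space)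
  then show "X \<in> measurable (vimage_algebra (space M) X N) N" by (rule measurable_vimage_algebra1)
  have "subalgebra M (vimage_algebra (space M) X N)"
    using assms by (auto simp: subalgebra_def sets_vimage_algebra2[OF X])
  then show "sigma_finite_subalgebra M (vimage_algebra (space M) X N)"
    by (intro finite_measure_subalgebra_is_sigma_finite finite_measure_subalgebra.intro
        finite_measure_axioms finite_measure_subalgebra_axioms.intro)
qed

text \<open>The factor \<open>g (X \<omega>)\<close> is measurable for the sigma-algebra of
  \<open>X\<close> and moves out of the conditional expectation.\<close>

lemma (in prob_space) integral_mult_cond_mean_zero:
  assumes X: "X \<in> measurable M N" and g: "g \<in> borel_measurable N" and \<epsilon>: "\<epsilon> \<in> borel_measurable M"
    and int: "integrable M (\<lambda>\<omega>. g (X \<omega>) * \<epsilon> \<omega>)"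
    and zero: "AE \<omega> in M. real_cond_exp M (vimage_algebra (space M) X N) \<epsilon> \<omega> = 0"
  shows "expectation (\<lambda>\<omega>. g (X \<omega>) * \<epsilon> \<omega>) = 0"
proof -
  let ?F = "vimage_algebra (space M) X N"
  interpret F: sigma_finite_subalgebra M ?F by (rule subalgebra_vimage[OF X])
  have g': "(\<lambda>\<omega>. g (X \<omega>)) \<in> borel_measurable ?F"
    using subalgebra_vimage(2)[OF X] g by (rule measurable_compose)
  have "expectation (\<lambda>\<omega>. g (X \<omega>) * \<epsilon> \<omega>) = expectation (\<lambda>\<omega>. g (X \<omega>) * real_cond_exp M ?F \<epsilon> \<omega>)"
    using F.real_cond_exp_intg(2)[OF int g' \<epsilon>] by simp
  also have "\<dots> = expectation (\<lambda>\<omega>. 0)"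
    using zero X g borel_measurable_cond_exp2 by (intro integral_cong_AE) auto
  finally show ?thesis by simp
qed

text \<open>Integrability of the product is the claim itself, so the conditioning is done with the
  nonnegative conditional expectation \<open>nn_cond_exp\<close>.\<close>

lemma (in prob_space) integrable_square_mult_cond_var_one:
  assumes X: "X \<in> measurable M N" and g: "g \<in> borel_measurable N" and \<epsilon>: "\<epsilon> \<in> borel_measurable M"
    and int: "integrable M (\<lambda>\<omega>. (g (X \<omega>))\<^sup>2)"
    and one: "AE \<omega> in M. real_cond_exp M (vimage_algebra (space M) X N) (\<lambda>\<omega>. (\<epsilon> \<omega>)\<^sup>2) \<omega> = 1"
  shows "integrable M (\<lambda>\<omega>. (g (X \<omega>) * \<epsilon> \<omega>)\<^sup>2)"
proof -
  let ?F = "vimage_algebra (space M) X N"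
  interpret F: sigma_finite_subalgebra M ?F by (rule subalgebra_vimage[OF X])
  have [measurable]: "(\<lambda>\<omega>. g (X \<omega>)) \<in> borel_measurable ?F"
    using subalgebra_vimage(2)[OF X] g by (rule measurable_compose)
  note [measurable] = X g \<epsilon>
  \<comment> \<open>\<open>real_cond_exp\<close> is a difference of two parts; the negative part of
    a square vanishes.\<close>
  have "AE \<omega> in M. nn_cond_exp M ?F (\<lambda>\<omega>. ennreal (- (\<epsilon> \<omega>)\<^sup>2)) \<omega> = 0"
    using F.nn_cond_exp_F_meas[of "\<lambda>_. 0"] by (auto simp: ennreal_neg)
  with one have nn: "AE \<omega> in M. nn_cond_exp M ?F (\<lambda>\<omega>. ennreal ((\<epsilon> \<omega>)\<^sup>2)) \<omega> = 1"
  proof eventually_elim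
    case (elim \<omega>)
    then have "enn2real (nn_cond_exp M ?F (\<lambda>\<omega>. ennreal ((\<epsilon> \<omega>)\<^sup>2)) \<omega>) = 1"
      by (simp add: real_cond_exp_def)
    \<comment> \<open>Since \<open>enn2real\<close> sends infinity to 0, the value 1 excludes
      infinity.\<close>
    then show ?case
      by (cases "nn_cond_exp M ?F (\<lambda>\<omega>. ennreal ((\<epsilon> \<omega>)\<^sup>2)) \<omega>") auto
  qed
  have "(\<integral>\<^sup>+\<omega>. ennreal ((g (X \<omega>) * \<epsilon> \<omega>)\<^sup>2) \<partial>M)
      = (\<integral>\<^sup>+\<omega>. ennreal ((g (X \<omega>))\<^sup>2) * ennreal ((\<epsilon> \<omega>)\<^sup>2) \<partial>M)"
    by (simp add: power_mult_distrib ennreal_mult)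
  also have "\<dots> = (\<integral>\<^sup>+\<omega>. ennreal ((g (X \<omega>))\<^sup>2) * nn_cond_exp M ?F (\<lambda>\<omega>. ennreal ((\<epsilon> \<omega>)\<^sup>2)) \<omega> \<partial>M)"
    by (intro F.nn_cond_exp_intg[symmetric]) auto
  also have "\<dots> = (\<integral>\<^sup>+\<omega>. ennreal ((g (X \<omega>))\<^sup>2) \<partial>M)"
    using nn by (intro nn_integral_cong_AE) auto
  also have "\<dots> < \<infinity>" using int by (simp add: integrable_iff_bounded)
  finally show ?thesis by (intro integrableI_nonneg) auto
qed

text \<open>By joint measurability of \<open>h\<close>, integrating over the generic pair with the
  data frozen leaves a measurable function of the data.\<close>

lemma (in prob_space) excess_risk_measurable:
  assumes est: "estimator_from M N Z I s" and Z: "\<And>i. i \<in> I \<Longrightarrow> Z i \<in> measurable M (N \<Otimes>\<^sub>M borel)"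
    and W: "W \<in> measurable M (N \<Otimes>\<^sub>M borel)" and r: "r \<in> borel_measurable N"
  shows "(\<lambda>\<omega>. excess_risk M W (s \<omega>) r) \<in> borel_measurable M"
proof -
  obtain h where h[measurable]: "h \<in> borel_measurable (PiM I (\<lambda>_. N \<Otimes>\<^sub>M borel) \<Otimes>\<^sub>M N)"
    and s: "\<And>\<omega> x. \<omega> \<in> space M \<Longrightarrow> x \<in> space N \<Longrightarrow> s \<omega> x = h (\<lambda>i\<in>I. Z i \<omega>, x)"
    using est unfolding estimator_from_def by blast
  note [measurable] = W r
  have [measurable]: "(\<lambda>\<omega>. \<lambda>i\<in>I. Z i \<omega>) \<in> measurable M (PiM I (\<lambda>_. N \<Otimes>\<^sub>M borel))"
    using Z by (intro measurable_restrict)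
  have sp: "fst (W \<omega>') \<in> space N" if "\<omega>' \<in> space M" for \<omega>'
    using measurable_space[OF W that] by (auto simp: space_pair_measure)
  have "(\<lambda>\<omega>. excess_risk M W (s \<omega>) r) \<in> borel_measurable M \<longleftrightarrow>
      (\<lambda>\<omega>. \<integral>\<omega>'. (snd (W \<omega>') - h (\<lambda>i\<in>I. Z i \<omega>, fst (W \<omega>')))\<^sup>2
        - (snd (W \<omega>') - r (fst (W \<omega>')))\<^sup>2 \<partial>M) \<in> borel_measurable M"
    unfolding excess_risk_def contrast_def case_prod_unfold
    by (intro measurable_cong Bochner_Integration.integral_cong) (auto simp: s sp)
  also have "\<dots>" by measurable
  finally show ?thesis .
qed

text \<open>Fixes the generic pair only; samples are introduced where empirical means are
  bounded.\<close>

locale regression_model = prob_space M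
  for M :: "'w measure" +
  fixes N :: "'a measure" and X :: "'w \<Rightarrow> 'a" and Y \<epsilon> :: "'w \<Rightarrow> real"
    and s_star \<sigma> s_o :: "'a \<Rightarrow> real" and S :: "('a \<Rightarrow> real) set"
  assumes X[measurable]: "X \<in> measurable M N" and Y[measurable]: "Y \<in> borel_measurable M"
    and model: "AE \<omega> in M. Y \<omega> = s_star (X \<omega>) + \<sigma> (X \<omega>) * \<epsilon> \<omega>"
    and \<epsilon>[measurable]: "\<epsilon> \<in> borel_measurable M"
    and eps_mean: "AE \<omega> in M. real_cond_exp M (vimage_algebra (space M) X N) \<epsilon> \<omega> = 0"
    and eps_var: "AE \<omega> in M. real_cond_exp M (vimage_algebra (space M) X N) (\<lambda>\<omega>. (\<epsilon> \<omega>)\<^sup>2) \<omega> = 1"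
    and s_star: "s_star \<in> L2_space (distr M N X)" and \<sigma>: "\<sigma> \<in> L2_space (distr M N X)"
    and S: "S \<subseteq> L2_space (distr M N X)" "linear_space S"
    and s_o: "orth_proj (distr M N X) S s_star s_o"
begin

abbreviation "\<nu> \<equiv> distr M N X"

lemma L2_space_comp: "f \<in> L2_space \<nu> \<Longrightarrow> f \<in> borel_measurable N"
  "f \<in> L2_space \<nu> \<Longrightarrow> (\<lambda>\<omega>. f (X \<omega>)) \<in> L2_space M"
  by (auto simp: L2_space_def integrable_distr_eq)

lemma s_o_in_S: "s_o \<in> S"
  using s_o by (simp add: orth_proj_def)

lemma S_L2: "t \<in> S \<Longrightarrow> t \<in> L2_space \<nu>"
  using S by auto

text \<open>Conditioning on \<open>X\<close> reduces the second moment of the noise to that of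
  \<open>\<sigma>\<close>.\<close>

lemma noise_L2: "(\<lambda>\<omega>. Y \<omega> - s_star (X \<omega>)) \<in> L2_space M"
proof -
  have [measurable]: "\<sigma> \<in> borel_measurable N" "s_star \<in> borel_measurable N"
    using L2_space_comp \<sigma> s_star by auto
  have "integrable M (\<lambda>\<omega>. (\<sigma> (X \<omega>) * \<epsilon> \<omega>)\<^sup>2)"
    using L2_space_comp(2)[OF \<sigma>] eps_var
    by (intro integrable_square_mult_cond_var_one[of X N]) (auto simp: L2_space_def)
  moreover have "AE \<omega> in M. (\<sigma> (X \<omega>) * \<epsilon> \<omega>)\<^sup>2 = (Y \<omega> - s_star (X \<omega>))\<^sup>2"
    using model by eventually_elim simp
  ultimately have "integrable M (\<lambda>\<omega>. (Y \<omega> - s_star (X \<omega>))\<^sup>2)"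
    by (subst (asm) integrable_cong_AE) auto
  then show ?thesis by (simp add: L2_space_def)
qed

lemma residual_L2:
  assumes "f \<in> L2_space \<nu>"
  shows "(\<lambda>\<omega>. Y \<omega> - f (X \<omega>)) \<in> L2_space M"
  using L2_space_add[OF noise_L2 L2_space_comp(2)[OF L2_space_diff[OF s_star assms]]] by simp

text \<open>The residual splits into the noise, orthogonal to functions of \<open>X\<close> by its
  conditional mean, and \<open>s_star - s_o\<close>, orthogonal to \<open>S\<close> by
  projection.\<close>

lemma residual_orthogonal:
  assumes u: "u \<in> S"
  shows "expectation (\<lambda>\<omega>. (Y \<omega> - s_o (X \<omega>)) * u (X \<omega>)) = 0"
proof -
  note L2 = S_L2[OF u] S_L2[OF s_o_in_S]
  have [measurable]: "\<sigma> \<in> borel_measurable N" "s_star \<in> borel_measurable N"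
      "u \<in> borel_measurable N" "s_o \<in> borel_measurable N"
    using L2_space_comp \<sigma> s_star L2 by auto
  have int: "integrable M (\<lambda>\<omega>. (Y \<omega> - s_star (X \<omega>)) * u (X \<omega>))"
    by (intro L2_space_mult_integrable noise_L2 L2_space_comp L2)
  have int': "integrable M (\<lambda>\<omega>. (s_star (X \<omega>) - s_o (X \<omega>)) * u (X \<omega>))"
    by (intro L2_space_mult_integrable L2_space_diff L2_space_comp L2 s_star)
  have AE: "AE \<omega> in M. (\<sigma> (X \<omega>) * u (X \<omega>)) * \<epsilon> \<omega> = (Y \<omega> - s_star (X \<omega>)) * u (X \<omega>)"
    using model by eventually_elim simp
  have "integrable M (\<lambda>\<omega>. (\<sigma> (X \<omega>) * u (X \<omega>)) * \<epsilon> \<omega>)"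
    using int AE by (subst integrable_cong_AE[OF _ _ AE]) auto
  then have "expectation (\<lambda>\<omega>. (\<sigma> (X \<omega>) * u (X \<omega>)) * \<epsilon> \<omega>) = 0"
    using eps_mean by (intro integral_mult_cond_mean_zero[of X N "\<lambda>x. \<sigma> x * u x"]) auto
  then have "expectation (\<lambda>\<omega>. (Y \<omega> - s_star (X \<omega>)) * u (X \<omega>)) = 0"
    using AE by (subst (asm) integral_cong_AE) auto
  moreover have "expectation (\<lambda>\<omega>. (s_star (X \<omega>) - s_o (X \<omega>)) * u (X \<omega>)) = 0"
    using s_o u integral_distr[OF X, of "\<lambda>x. (s_star x - s_o x) * u x"] by (simp add: orth_proj_def)
  moreover have "(Y \<omega> - s_o (X \<omega>)) * u (X \<omega>) = (Y \<omega> - s_star (X \<omega>)) * u (X \<omega>)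
      + (s_star (X \<omega>) - s_o (X \<omega>)) * u (X \<omega>)" for \<omega>
    by (simp add: algebra_simps)
  ultimately show ?thesis using int int' by simp
qed

text \<open>Pythagoras, the cross term vanishing by \<open>residual_orthogonal\<close>. The theorem
  thereby reduces to bounding the distance from the selected estimator to
  \<open>s_o\<close>.\<close>

lemma excess_risk_projection:
  assumes t: "t \<in> S"
  shows "excess_risk M (\<lambda>\<omega>. (X \<omega>, Y \<omega>)) t s_star
    = excess_risk M (\<lambda>\<omega>. (X \<omega>, Y \<omega>)) s_o s_star + (\<integral>x. (t x - s_o x)\<^sup>2 \<partial>\<nu>)"
proof -
  let ?R = "\<lambda>f. expectation (\<lambda>\<omega>. (Y \<omega> - f (X \<omega>))\<^sup>2)"
  define u where "u = (\<lambda>x. t x - s_o x)"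
  have u: "u \<in> S" unfolding u_def by (intro linear_space_diff S t s_o_in_S)
  note L2 = S_L2[OF t] S_L2[OF s_o_in_S] S_L2[OF u]
  have int: "integrable M (\<lambda>\<omega>. (Y \<omega> - f (X \<omega>))\<^sup>2)" if "f \<in> L2_space \<nu>" for f
    using residual_L2[OF that] by (simp add: L2_space_def)
  have er: "excess_risk M (\<lambda>\<omega>. (X \<omega>, Y \<omega>)) f s_star = ?R f - ?R s_star" if "f \<in> L2_space \<nu>" for f
    using int[OF that] int[OF s_star] by (simp add: excess_risk_def contrast_def)
  have "(Y \<omega> - t (X \<omega>))\<^sup>2 = (Y \<omega> - s_o (X \<omega>))\<^sup>2 - 2 * ((Y \<omega> - s_o (X \<omega>)) * u (X \<omega>)) + (u (X \<omega>))\<^sup>2" for \<omega>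
    by (simp add: u_def power2_eq_square algebra_simps)
  moreover have "integrable M (\<lambda>\<omega>. (Y \<omega> - s_o (X \<omega>)) * u (X \<omega>))"
    by (intro L2_space_mult_integrable residual_L2 L2_space_comp L2)
  moreover have "integrable M (\<lambda>\<omega>. (u (X \<omega>))\<^sup>2)"
    using L2_space_comp(2)[OF L2(3)] by (simp add: L2_space_def)
  ultimately have "?R t = ?R s_o + expectation (\<lambda>\<omega>. (u (X \<omega>))\<^sup>2)"
    using int[OF L2(2)] residual_orthogonal[OF u] by simp
  also have "expectation (\<lambda>\<omega>. (u (X \<omega>))\<^sup>2) = (\<integral>x. (u x)\<^sup>2 \<partial>\<nu>)"
    using L2_space_comp(1)[OF L2(3)] by (intro integral_distr[symmetric] X) auto
  finally show ?thesis
    using er L2 by (simp add: u_def)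
qed

text \<open>Both failures are tails of sums of squared empirical means. As the sum of the squared
  basis functions is at most \<open>Psi\<close>, the total second moments are at most
  \<open>D\<close> for the residual means and \<open>C\<close> for the Gram entries.\<close>

lemma bad_block_prob:
  fixes Z :: "nat \<Rightarrow> 'w \<Rightarrow> 'a \<times> real"
  assumes D: "0 \<le> D" "(\<integral>\<^sup>+\<omega>. ennreal ((Y \<omega> - s_o (X \<omega>))\<^sup>2) * Psi \<nu> S (X \<omega>) \<partial>M) \<le> ennreal D"
    and C: "0 \<le> C" "(\<integral>\<^sup>+\<omega>. (Psi \<nu> S (X \<omega>))\<^sup>2 \<partial>M) \<le> ennreal C"
    and on: "orthonormal_in \<nu> S m \<psi>"
    and I: "finite I" "I \<noteq> {}" and indep: "indep_vars (\<lambda>_. N \<Otimes>\<^sub>M borel) Z I"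
    and ident: "\<And>i. i \<in> I \<Longrightarrow>
      distr M (N \<Otimes>\<^sub>M borel) (Z i) = distr M (N \<Otimes>\<^sub>M borel) (\<lambda>\<omega>. (X \<omega>, Y \<omega>))"
    and p: "0 \<le> p" "D / card I \<le> p * a\<^sup>2" "0 \<le> p'" "C / card I \<le> p' / 4"
  shows "prob {\<omega>\<in>space M.
      a\<^sup>2 < (\<Sum>j<m. (emp_mean I (\<lambda>i. Z i \<omega>) (\<lambda>(x, y). (y - s_o x) * \<psi> j x))\<^sup>2) \<or>
      1 / 4 < (\<Sum>j<m. \<Sum>k<m. (emp_mean I (\<lambda>i. Z i \<omega>) (\<lambda>(x, y). \<psi> j x * \<psi> k x - of_bool (j = k)))\<^sup>2)}
    \<le> p + p'" (is "prob {\<omega>\<in>space M. ?W \<omega> \<or> ?Q \<omega>} \<le> _")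
proof -
  let ?\<mu> = "distr M (N \<Otimes>\<^sub>M borel) (\<lambda>\<omega>. (X \<omega>, Y \<omega>))"
  let ?f = "\<lambda>j (x, y). (y - s_o x) * \<psi> j x"
  let ?g = "\<lambda>(j, k) (x, y). \<psi> j x * \<psi> k x - of_bool (j = k)"
  have Z[measurable]: "Z i \<in> measurable M (N \<Otimes>\<^sub>M borel)" if "i \<in> I" for i
    using indep that by (auto simp: indep_vars_def)
  have \<psi>: "\<psi> j \<in> S" if "j < m" for j using on that by (simp add: orthonormal_in_def)
  have \<psi>_meas[measurable]: "\<psi> j \<in> borel_measurable N" if "j < m" for j
    using L2_space_comp(1) S_L2 \<psi> that by auto
  have [measurable]: "s_o \<in> borel_measurable N" using L2_space_comp(1) S_L2 s_o_in_S by auto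
  have Psi: "ennreal (\<Sum>j<m. (\<psi> j x)\<^sup>2) \<le> Psi \<nu> S x" for x
    by (rule orthonormal_sum_squares_le_Psi[OF S on])
  have "(\<integral>\<^sup>+\<omega>. ennreal (\<Sum>j<m. ((Y \<omega> - s_o (X \<omega>)) * \<psi> j (X \<omega>))\<^sup>2) \<partial>M)
      \<le> (\<integral>\<^sup>+\<omega>. ennreal ((Y \<omega> - s_o (X \<omega>))\<^sup>2) * Psi \<nu> S (X \<omega>) \<partial>M)"
    using Psi by (intro nn_integral_mono)
      (auto simp: power_mult_distrib ennreal_mult sum_nonneg mult_left_mono simp flip: sum_distrib_left)
  with D(2) have f: "(\<integral>\<^sup>+\<omega>. ennreal (\<Sum>j<m. ((Y \<omega> - s_o (X \<omega>)) * \<psi> j (X \<omega>))\<^sup>2) \<partial>M) \<le> ennreal D"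
    by (rule order_trans[rotated])
  have f_L2: "integrable M (\<lambda>\<omega>. ((Y \<omega> - s_o (X \<omega>)) * \<psi> j (X \<omega>))\<^sup>2)" if "j < m" for j
    using that integrable_family_of_nn_integral_le(1)[OF _ _ _ f D(1)] by auto
  have f_sum: "(\<Sum>j<m. expectation (\<lambda>\<omega>. ((Y \<omega> - s_o (X \<omega>)) * \<psi> j (X \<omega>))\<^sup>2)) \<le> D"
    using integrable_family_of_nn_integral_le(2)[OF _ _ _ f D(1)] by auto
  have W: "prob {\<omega>\<in>space M. ?W \<omega>} \<le> p"
  proof (rule emp_mean_family_tail[OF I _ indep ident])
    fix j assume "j \<in> {..<m}"
    then have j: "j < m" by simp
    have "integrable M (\<lambda>\<omega>. (Y \<omega> - s_o (X \<omega>)) * \<psi> j (X \<omega>))"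
      using \<psi>[OF j] s_o_in_S by (intro L2_space_mult_integrable residual_L2 L2_space_comp S_L2)
    then show "integrable ?\<mu> (?f j)" using j by (subst integrable_distr_eq) auto
    show "integrable ?\<mu> (\<lambda>z. (?f j z)\<^sup>2)"
      using j f_L2 by (subst integrable_distr_eq) auto
    show "(\<integral>z. ?f j z \<partial>?\<mu>) = 0"
      using j residual_orthogonal[OF \<psi>[OF j]] by (subst integral_distr) auto
  next
    have "(\<Sum>j<m. \<integral>z. (?f j z)\<^sup>2 \<partial>?\<mu>)
        = (\<Sum>j<m. expectation (\<lambda>\<omega>. ((Y \<omega> - s_o (X \<omega>)) * \<psi> j (X \<omega>))\<^sup>2))"
      by (intro sum.cong refl) (subst integral_distr, auto)
    with f_sum show "(\<Sum>j<m. \<integral>z. (?f j z)\<^sup>2 \<partial>?\<mu>) \<le> D" by simp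
  qed (use p in auto)
  have "(\<integral>\<^sup>+\<omega>. ennreal (\<Sum>(j, k)\<in>{..<m} \<times> {..<m}. (\<psi> j (X \<omega>) * \<psi> k (X \<omega>))\<^sup>2) \<partial>M)
      \<le> (\<integral>\<^sup>+\<omega>. (Psi \<nu> S (X \<omega>))\<^sup>2 \<partial>M)"
  proof (rule nn_integral_mono)
    fix \<omega>
    \<comment> \<open>The double sum factors into the square of the sum bounded by
      \<open>Psi\<close>.\<close>
    have "ennreal (\<Sum>(j, k)\<in>{..<m} \<times> {..<m}. (\<psi> j (X \<omega>) * \<psi> k (X \<omega>))\<^sup>2)
        = (ennreal (\<Sum>j<m. (\<psi> j (X \<omega>))\<^sup>2))\<^sup>2"
      by (simp add: power_mult_distrib power2_eq_square[of "\<Sum>j<m. _ j"] sum_product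
          sum.cartesian_product sum_nonneg ennreal_power)
    also have "\<dots> \<le> (Psi \<nu> S (X \<omega>))\<^sup>2" by (intro power_mono Psi) auto
    finally show "ennreal (\<Sum>(j, k)\<in>{..<m} \<times> {..<m}. (\<psi> j (X \<omega>) * \<psi> k (X \<omega>))\<^sup>2)
        \<le> (Psi \<nu> S (X \<omega>))\<^sup>2" .
  qed
  with C(2) have g: "(\<integral>\<^sup>+\<omega>. ennreal (\<Sum>jk\<in>{..<m} \<times> {..<m}.
      (\<psi> (fst jk) (X \<omega>) * \<psi> (snd jk) (X \<omega>))\<^sup>2) \<partial>M) \<le> ennreal C"
    by (simp add: case_prod_unfold)
  have g_L2: "integrable M (\<lambda>\<omega>. (\<psi> j (X \<omega>) * \<psi> k (X \<omega>))\<^sup>2)" if "j < m" "k < m" for j k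
    using that integrable_family_of_nn_integral_le(1)[OF _ _ _ g C(1), of "(j, k)"] by auto
  have g_sum: "(\<Sum>jk\<in>{..<m} \<times> {..<m}. expectation (\<lambda>\<omega>. (\<psi> (fst jk) (X \<omega>) * \<psi> (snd jk) (X \<omega>))\<^sup>2)) \<le> C"
    using integrable_family_of_nn_integral_le(2)[OF _ _ _ g C(1)] by auto
  have g_int: "integrable M (\<lambda>\<omega>. \<psi> j (X \<omega>) * \<psi> k (X \<omega>))" if "j < m" "k < m" for j k
    using that \<psi> by (intro L2_space_mult_integrable L2_space_comp S_L2)
  have g_exp: "expectation (\<lambda>\<omega>. \<psi> j (X \<omega>) * \<psi> k (X \<omega>)) = of_bool (j = k)" if "j < m" "k < m" for j k
    using on that integral_distr[OF X, of "\<lambda>x. \<psi> j x * \<psi> k x"] by (simp add: orthonormal_in_def)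
  \<comment> \<open>The subtracted constant is the mean, and a variance is at most the second
    moment.\<close>
  have g_centred: "integrable M (\<lambda>\<omega>. (\<psi> j (X \<omega>) * \<psi> k (X \<omega>) - of_bool (j = k))\<^sup>2)"
      "expectation (\<lambda>\<omega>. (\<psi> j (X \<omega>) * \<psi> k (X \<omega>) - of_bool (j = k))\<^sup>2)
        \<le> expectation (\<lambda>\<omega>. (\<psi> j (X \<omega>) * \<psi> k (X \<omega>))\<^sup>2)" if "j < m" "k < m" for j k
    using g_L2[OF that] g_int[OF that] g_exp[OF that] by (auto simp: power2_diff prob_space)
  have Q: "prob {\<omega>\<in>space M. 1 / 4 < (\<Sum>jk\<in>{..<m} \<times> {..<m}. (emp_mean I (\<lambda>i. Z i \<omega>) (?g jk))\<^sup>2)} \<le> p'"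
  proof (rule emp_mean_family_tail[OF I _ indep ident])
    fix jk assume "jk \<in> {..<m} \<times> {..<m}"
    then obtain j k where jk: "jk = (j, k)" "j < m" "k < m" by auto
    show "integrable ?\<mu> (?g jk)" "integrable ?\<mu> (\<lambda>z. (?g jk z)\<^sup>2)"
      using jk g_int g_centred by (subst integrable_distr_eq; auto)+
    show "(\<integral>z. ?g jk z \<partial>?\<mu>) = 0"
      using jk g_int[of j k] g_exp[of j k] by (subst integral_distr) (auto simp: prob_space)
  next
    have "(\<Sum>jk\<in>{..<m} \<times> {..<m}. \<integral>z. (?g jk z)\<^sup>2 \<partial>?\<mu>)
        \<le> (\<Sum>jk\<in>{..<m} \<times> {..<m}. expectation (\<lambda>\<omega>. (\<psi> (fst jk) (X \<omega>) * \<psi> (snd jk) (X \<omega>))\<^sup>2))"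
    proof (rule sum_mono)
      fix jk assume "jk \<in> {..<m} \<times> {..<m}"
      then show "(\<integral>z. (?g jk z)\<^sup>2 \<partial>?\<mu>) \<le> expectation (\<lambda>\<omega>. (\<psi> (fst jk) (X \<omega>) * \<psi> (snd jk) (X \<omega>))\<^sup>2)"
        using g_centred by (subst integral_distr) auto
    qed
    with g_sum show "(\<Sum>jk\<in>{..<m} \<times> {..<m}. \<integral>z. (?g jk z)\<^sup>2 \<partial>?\<mu>) \<le> C" by simp
  qed (use p in auto)
  have Q': "prob {\<omega>\<in>space M. ?Q \<omega>} \<le> p'"
    using Q by (simp add: sum.cartesian_product case_prod_unfold)
  have em: "(\<lambda>\<omega>. emp_mean I (\<lambda>i. Z i \<omega>) f) \<in> borel_measurable M"
    if "f \<in> borel_measurable (N \<Otimes>\<^sub>M borel)" for f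
    unfolding emp_mean_def using that
    by (intro borel_measurable_divide borel_measurable_sum) (auto intro: measurable_compose[OF Z])
  have "{\<omega>\<in>space M. ?W \<omega>} \<in> events" "{\<omega>\<in>space M. ?Q \<omega>} \<in> events"
    by (intro borel_measurable_less borel_measurable_const borel_measurable_sum
        borel_measurable_power em; simp)+
  then have "prob ({\<omega>\<in>space M. ?W \<omega>} \<union> {\<omega>\<in>space M. ?Q \<omega>})
      \<le> prob {\<omega>\<in>space M. ?W \<omega>} + prob {\<omega>\<in>space M. ?Q \<omega>}"
    by (rule measure_Un_le)
  also have "{\<omega>\<in>space M. ?W \<omega>} \<union> {\<omega>\<in>space M. ?Q \<omega>} = {\<omega>\<in>space M. ?W \<omega> \<or> ?Q \<omega>}" by blast
  finally show ?thesis using W Q' by linarith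
qed

end

section \<open>Selection by medians of means\<close>

text \<open>\<open>sqrt 2 * L1\<close> is at least 7, which contributes 896 e; the missing 76 e is
  less than 384.\<close>

lemma L7_lower_bound: "972 * exp 1 \<le> L7"
proof -
  have e: "2 \<le> exp (1::real)" using exp_ge_add_one_self[of 1] by simp
  have "exp (-2) = inverse (exp 1 * exp (1::real))"
    by (simp add: exp_minus flip: exp_add)
  also have "\<dots> \<le> inverse (2 * 2)" using e by (intro le_imp_inverse_le mult_mono) auto
  finally have e2: "exp (-2) \<le> (1 / 4 :: real)" by simp
  have "43 / 50 \<le> sqrt (1 - exp (-2 :: real))"
    using e2 by (intro real_le_rsqrt) (simp add: power2_eq_square)
  moreover have "sqrt (1 - exp (-2 :: real)) < 1" by simp
  ultimately have r: "0 < r_const" "r_const \<le> 7 / 100" by (auto simp: r_const_def)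
  have "28 \<le> 2 / r_const" using r by (simp add: field_simps)
  then have "sqrt 28 \<le> L1" unfolding L1_def by (rule real_sqrt_le_mono)
  then have "sqrt 2 * sqrt 28 \<le> sqrt 2 * L1" by (intro mult_left_mono) auto
  moreover have "7 \<le> sqrt 2 * sqrt (28 :: real)"
    unfolding real_sqrt_mult[symmetric] by (intro real_le_rsqrt) simp
  ultimately have "7 \<le> sqrt 2 * L1" by linarith
  then have "128 * exp 1 * 7 \<le> 128 * exp 1 * (sqrt 2 * L1)" by (intro mult_left_mono) auto
  moreover have "exp 1 < (272 / 100 :: real)" by (rule e_less_272)
  moreover have "L7 = 384 + 128 * exp 1 * (sqrt 2 * L1)" by (simp add: L7_def mult_ac)
  ultimately show ?thesis by linarith
qed

text \<open>Since \<open>n / V\<close> is at least 2, losing 1 leaves at least half of it in each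
  block.\<close>

lemma regular_partition_block:
  assumes B: "regular_partition n V B" and V: "0 < V" "real V \<le> real n / 2" and K: "K \<in> {1..V}"
  shows "B K \<subseteq> {1..n}" "finite (B K)" "B K \<noteq> {}" "real n \<le> 2 * real V * real (card (B K))"
proof -
  show sub: "B K \<subseteq> {1..n}" using B K by (auto simp: regular_partition_def)
  then show "finite (B K)" by (rule finite_subset) simp
  have "\<bar>real (card (B K)) - real n / real V\<bar> \<le> 1" using B K by (auto simp: regular_partition_def)
  moreover have "2 \<le> real n / real V" using V by (simp add: field_simps)
  ultimately have *: "real n / real V \<le> 2 * real (card (B K))" by linarith
  then show "real n \<le> 2 * real V * real (card (B K))" using V by (simp add: field_simps)
  show "B K \<noteq> {}" using * \<open>2 \<le> real n / real V\<close> by auto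
qed

theorem proposition15:
  fixes M :: "'w measure" and N :: "'a measure"
    and X :: "nat \<Rightarrow> 'w \<Rightarrow> 'a" and Y :: "nat \<Rightarrow> 'w \<Rightarrow> real" and \<epsilon> :: "'w \<Rightarrow> real"
    and Z :: "nat \<Rightarrow> 'w \<Rightarrow> 'a \<times> real" and P_X :: "'a measure"
    and s_star \<sigma> s_o :: "'a \<Rightarrow> real" and S :: "('a \<Rightarrow> real) set"
    and D M_Psi \<delta> :: real and n V :: nat and B :: "nat \<Rightarrow> nat set"
    and s_hat :: "nat \<Rightarrow> 'w \<Rightarrow> 'a \<Rightarrow> real"
    and P_med :: "nat \<Rightarrow> nat \<Rightarrow> ('a \<times> real \<Rightarrow> real) \<Rightarrow> 'w \<Rightarrow> real"
    and K_star :: "'w \<Rightarrow> nat"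
  assumes prob: "prob_space M"
    \<comment> \<open>index 0 is the generic pair, indices 1 to n are the sample\<close>
    and Z: "Z = (\<lambda>i \<omega>. (X i \<omega>, Y i \<omega>))"
    and indep: "prob_space.indep_vars M (\<lambda>_. N \<Otimes>\<^sub>M borel) Z {0..n}"
    and ident: "\<And>i. i \<in> {1..n} \<Longrightarrow> distr M (N \<Otimes>\<^sub>M borel) (Z i) = distr M (N \<Otimes>\<^sub>M borel) (Z 0)"
    and P_X: "P_X = distr M N (X 0)"
    and model: "AE \<omega> in M. Y 0 \<omega> = s_star (X 0 \<omega>) + \<sigma> (X 0 \<omega>) * \<epsilon> \<omega>"
    and eps_int: "integrable M \<epsilon>" "integrable M (\<lambda>\<omega>. (\<epsilon> \<omega>)\<^sup>2)"
    and eps_mean: "AE \<omega> in M. real_cond_exp M (vimage_algebra (space M) (X 0) N) \<epsilon> \<omega> = 0"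
    and eps_var: "AE \<omega> in M.
          real_cond_exp M (vimage_algebra (space M) (X 0) N) (\<lambda>\<omega>. (\<epsilon> \<omega>)\<^sup>2) \<omega> = 1"
    and L2: "s_star \<in> L2_space P_X" "\<sigma> \<in> L2_space P_X"
    and S: "S \<subseteq> L2_space P_X" "linear_space S"
    and s_o: "orth_proj P_X S s_star s_o"
    and Psi_meas: "Psi P_X S \<in> borel_measurable N"
    and D: "0 \<le> D"
      "(\<integral>\<^sup>+\<omega>. ennreal ((Y 0 \<omega> - s_o (X 0 \<omega>))\<^sup>2) * Psi P_X S (X 0 \<omega>) \<partial>M) \<le> ennreal D"
    and M_Psi: "0 \<le> M_Psi" "(\<integral>\<^sup>+\<omega>. (Psi P_X S (X 0 \<omega>))\<^sup>2 \<partial>M) \<le> ennreal M_Psi"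
    and delta: "\<delta> > 0" "real_of_int \<lceil>ln (1 / \<delta>\<^sup>2)\<rceil> \<le> real n / 2"
    and V: "int V = max \<lceil>ln (1 / \<delta>\<^sup>2)\<rceil> 8" "real V \<le> real n / 2"
    and B: "regular_partition n V B"
    and s_hat: "\<And>K. K \<in> {1..V} \<Longrightarrow> estimator_from M N Z (B K) (s_hat K)"
      "\<And>K. K \<in> {1..V} \<Longrightarrow>
         AE \<omega> in M. is_arg_min (\<lambda>t. emp_mean (B K) (\<lambda>i. Z i \<omega>) (contrast t))
           (\<lambda>t. t \<in> S) (s_hat K \<omega>)"
    and P_med: "\<And>K K' f \<omega>. K \<in> {1..V} \<Longrightarrow> K' \<in> {1..V} \<Longrightarrow> \<omega> \<in> space M \<Longrightarrow>
         is_median ({1..V} - {K, K'}) (\<lambda>J. emp_mean (B J) (\<lambda>i. Z i \<omega>) f) (P_med K K' f \<omega>)"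
    and K_star: "K_star \<in> measurable M (count_space UNIV)"
      "\<And>\<omega>. \<omega> \<in> space M \<Longrightarrow>
         is_arg_min
           (\<lambda>K. MAX K'\<in>{1..V}.
              P_med K K' (\<lambda>z. contrast (s_hat K \<omega>) z - contrast (s_hat K' \<omega>) z) \<omega>)
           (\<lambda>K. K \<in> {1..V}) (K_star \<omega>)"
    and n_large: "96 * exp 1 * M_Psi * real V \<le> real n"
  shows "prob_space.prob M {\<omega> \<in> space M.
           excess_risk M (Z 0) (s_hat (K_star \<omega>) \<omega>) s_star
             \<le> excess_risk M (Z 0) s_o s_star + L7 * (D * real V / real n)} \<ge> 1 - 3 * \<delta>"
proof -
  interpret prob_space M by (rule prob)
  have Z_meas: "Z i \<in> measurable M (N \<Otimes>\<^sub>M borel)" if "i \<in> {0..n}" for i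
    using indep that by (auto simp: indep_vars_def)
  have X_eq: "X i = (\<lambda>\<omega>. fst (Z i \<omega>))" and Y_eq: "Y i = (\<lambda>\<omega>. snd (Z i \<omega>))" for i
    by (auto simp: Z)
  have X_meas: "X i \<in> measurable M N" and Y_meas: "Y i \<in> borel_measurable M" if "i \<in> {0..n}" for i
    unfolding X_eq Y_eq using Z_meas[OF that] by auto
  interpret regression_model M N "X 0" "Y 0" \<epsilon> s_star \<sigma> s_o S
    using model eps_int eps_mean eps_var L2 S s_o X_meas[of 0] Y_meas[of 0]
    by unfold_locales (auto simp: P_X)
  note [simp] = P_X
  have Z0: "Z 0 = (\<lambda>\<omega>. (X 0 \<omega>, Y 0 \<omega>))" by (simp add: Z)
  have V8: "8 \<le> V" using V(1) by linarith
  then have V0: "0 < V" and n0: "0 < n" using V(2) by auto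
  note block = regular_partition_block[OF B V0 V(2)]

  \<comment> \<open>Integrability of the envelope and a finite basis\<close>
  have Psi2: "(\<integral>\<^sup>+x. (Psi P_X S x)\<^sup>2 \<partial>P_X) \<le> ennreal M_Psi"
    using M_Psi(2) Psi_meas X_meas[of 0] by (simp add: nn_integral_distr)
  \<comment> \<open>On a probability space this derives integrability of \<open>Psi\<close> from
    that of its square, infinite values included.\<close>
  have Psi_le: "p \<le> 1 + p\<^sup>2" for p :: ennreal
  proof (cases "p \<le> 1")
    case True
    then show ?thesis by (simp add: add_increasing2)
  next
    case False
    then have "p * 1 \<le> p * p" by (intro mult_left_mono) auto
    then show ?thesis by (simp add: power2_eq_square add_increasing)
  qed
  have "(\<integral>\<^sup>+x. Psi P_X S x \<partial>P_X) \<le> (\<integral>\<^sup>+x. 1 + (Psi P_X S x)\<^sup>2 \<partial>P_X)"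
    by (intro nn_integral_mono Psi_le)
  also have "\<dots> = emeasure P_X (space P_X) + (\<integral>\<^sup>+x. (Psi P_X S x)\<^sup>2 \<partial>P_X)"
    using Psi_meas by (subst nn_integral_add) auto
  also have "\<dots> < \<infinity>"
    using Psi2 prob_space.emeasure_space_1[OF prob_space_distr[OF X_meas[of 0]]]
    by (auto simp: le_less_trans)
  finally have Psi_int: "(\<integral>\<^sup>+x. Psi P_X S x \<partial>P_X) < \<infinity>" .
  then have Psi_fin: "AE x in P_X. Psi P_X S x < \<infinity>"
    using nn_integral_PInf_AE[of "Psi P_X S" P_X] Psi_meas by (auto simp: less_top)
  obtain m \<psi> where on: "orthonormal_in P_X S m \<psi>"
    and basis: "\<And>u x. u \<in> S \<Longrightarrow> Psi P_X S x < \<infinity> \<Longrightarrow>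
      u x = (\<Sum>i<m. (\<integral>z. u z * \<psi> i z \<partial>P_X) * \<psi> i x)"
    using orthonormal_basis_exists[of S P_X] S Psi_int by auto
  have \<psi>_meas: "\<psi> j \<in> borel_measurable N" if "j < m" for j
    using on that L2_space_comp(1) S_L2 by (auto simp: orthonormal_in_def)
  have s_o_meas: "s_o \<in> borel_measurable N" using L2_space_comp(1) S_L2 s_o_in_S by auto

  \<comment> \<open>Bad blocks: independence and probability\<close>
  define a where "a = sqrt (12 * exp 1 * D * V / n)"
  \<comment> \<open>A block has at least n / (2 V) points, so \<open>D / card (B J)\<close> is at
    most 2 D V / n, which is a^2 / (6 e).\<close>
  have a: "0 \<le> a" "a\<^sup>2 = 12 * exp 1 * D * V / n" using D(1) by (auto simp: a_def)
  \<comment> \<open>Stated for data \<open>z\<close> rather than outcomes, so that the event of a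
    bad block is a preimage under the data of that block alone and inherits independence.\<close>
  define bad where "bad = (\<lambda>I z.
    a\<^sup>2 < (\<Sum>j<m. (emp_mean I z (\<lambda>(x, y). (y - s_o x) * \<psi> j x))\<^sup>2) \<or>
    1 / 4 < (\<Sum>j<m. \<Sum>k<m. (emp_mean I z (\<lambda>(x, y). \<psi> j x * \<psi> k x - of_bool (j = k)))\<^sup>2))"
  define E where "E = (\<lambda>J. {\<omega>\<in>space M. bad (B J) (\<lambda>i. Z i \<omega>)})"
  define Dat where "Dat = (\<lambda>J. PiM (B J) (\<lambda>_. N \<Otimes>\<^sub>M (borel :: real measure)))"
  define A where "A = (\<lambda>J. {z \<in> space (Dat J). bad (B J) z})"
  have A: "A J \<in> sets (Dat J)" for J
  proof -
    have em: "(\<lambda>z. emp_mean (B J) z f) \<in> borel_measurable (Dat J)"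
      if "f \<in> borel_measurable (N \<Otimes>\<^sub>M borel)" for f
      unfolding emp_mean_def Dat_def using that
      by (intro borel_measurable_divide borel_measurable_sum)
         (auto intro: measurable_compose[OF measurable_component_singleton])
    have "{z \<in> space (Dat J). a\<^sup>2 < (\<Sum>j<m. (emp_mean (B J) z (\<lambda>(x, y). (y - s_o x) * \<psi> j x))\<^sup>2)}
        \<in> sets (Dat J)"
      "{z \<in> space (Dat J). 1 / 4 < (\<Sum>j<m. \<Sum>k<m.
          (emp_mean (B J) z (\<lambda>(x, y). \<psi> j x * \<psi> k x - of_bool (j = k)))\<^sup>2)} \<in> sets (Dat J)"
      using s_o_meas \<psi>_meas
      by (intro borel_measurable_less borel_measurable_const borel_measurable_sum
          borel_measurable_power em; simp)+
    then show ?thesis unfolding A_def bad_def by (intro sets.sets_Collect_disj)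
  qed
  have indep_blocks: "indep_vars Dat (\<lambda>J \<omega>. restrict (\<lambda>i. Z i \<omega>) (B J)) {1..V}"
    unfolding Dat_def using B block(1)
    by (intro indep_vars_restrict[OF indep]) (force simp: regular_partition_def)+
  have E_eq: "E J = (\<lambda>\<omega>. restrict (\<lambda>i. Z i \<omega>) (B J)) -` A J \<inter> space M" if "J \<in> {1..V}" for J
  proof -
    have "(\<lambda>\<omega>. restrict (\<lambda>i. Z i \<omega>) (B J)) \<in> measurable M (Dat J)"
      using indep_blocks that by (simp add: indep_vars_def)
    moreover have "emp_mean (B J) (restrict z (B J)) f = emp_mean (B J) z f"
      for z and f :: "'a \<times> real \<Rightarrow> real"
      by (simp add: emp_mean_def)
    then have "bad (B J) (restrict z (B J)) = bad (B J) z" for z by (simp add: bad_def)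
    ultimately show ?thesis by (auto simp: E_def A_def dest: measurable_space)
  qed
  have E_event: "E J \<in> events" if "J \<in> {1..V}" for J
  proof -
    have "(\<lambda>\<omega>. restrict (\<lambda>i. Z i \<omega>) (B J)) \<in> measurable M (Dat J)"
      using indep_blocks that by (simp add: indep_vars_def)
    then show ?thesis unfolding E_eq[OF that] using A by (rule measurable_sets)
  qed
  have E_indep: "prob (\<Inter>J\<in>T. E J) = (\<Prod>J\<in>T. prob (E J))" if "T \<subseteq> {1..V}" "T \<noteq> {}" for T
  proof -
    have "finite T" using that by (auto intro: finite_subset)
    then have "prob (\<Inter>J\<in>T. (\<lambda>\<omega>. restrict (\<lambda>i. Z i \<omega>) (B J)) -` A J \<inter> space M)
        = (\<Prod>J\<in>T. prob ((\<lambda>\<omega>. restrict (\<lambda>i. Z i \<omega>) (B J)) -` A J \<inter> space M))"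
      using that A by (intro indep_varsD[OF indep_blocks]) auto
    moreover have "J \<in> {1..V}" if "J \<in> T" for J using that \<open>T \<subseteq> {1..V}\<close> by blast
    ultimately show ?thesis by (simp add: E_eq cong: INF_cong prod.cong)
  qed
  have E_prob: "prob (E J) \<le> 1 / (4 * exp 1)" if J: "J \<in> {1..V}" for J
  proof -
    have c: "0 < real (card (B J))" using block[OF J] by (simp add: card_gt_0_iff)
    have "D * n \<le> D * (2 * real V * card (B J))" using block(4)[OF J] D(1) by (rule mult_left_mono)
    then have "D / card (B J) \<le> 1 / (6 * exp 1) * a\<^sup>2"
      unfolding a using c n0 by (simp add: field_simps)
    moreover have "M_Psi / card (B J) \<le> 1 / (12 * exp 1) / 4"
    proof -
      \<comment> \<open>Both sides are compared through \<open>n\<close>, using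
        \<open>n_large\<close> and the lower bound on the block size.\<close>
      have "(48 * exp 1 * M_Psi) * (2 * real V) \<le> card (B J) * (2 * real V)"
        using n_large block(4)[OF J] by (simp add: mult_ac)
      then have "48 * exp 1 * M_Psi \<le> card (B J)" using V0 by (simp add: mult_ac)
      then show ?thesis using c by (simp add: field_simps)
    qed
    moreover have "indep_vars (\<lambda>_. N \<Otimes>\<^sub>M borel) Z (B J)"
      using block(1)[OF J] by (intro indep_vars_subset[OF indep]) force
    ultimately have "prob (E J) \<le> 1 / (6 * exp 1) + 1 / (12 * exp 1)"
      unfolding E_def bad_def
      using D M_Psi on block[OF J] ident
      by (intro bad_block_prob) (auto simp: Z0)
    also have "\<dots> = 1 / (4 * exp (1::real))" by (simp add: field_simps)
    finally show ?thesis .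
  qed

  \<comment> \<open>Few bad blocks with high probability\<close>
  define k where "k = (V - 1) div 2"
  \<comment> \<open>Outside \<open>F\<close> at most \<open>k - 1\<close> blocks are bad; twice this
    plus 2 is \<open>2 * k\<close>, still below \<open>V\<close>.\<close>
  define F where "F = {\<omega>\<in>space M. k \<le> card {J\<in>{1..V}. \<omega> \<in> E J}}"
  have "real V \<ge> - 2 * ln \<delta>"
  proof -
    have "real_of_int \<lceil>ln (1 / \<delta>\<^sup>2)\<rceil> \<le> real V" using V(1) by linarith
    moreover have "ln (1 / \<delta>\<^sup>2) = - 2 * ln \<delta>"
      using delta(1) by (simp add: ln_div ln_realpow)
    ultimately show ?thesis by linarith
  qed
  then have "exp (- real V / 2) \<le> exp (ln \<delta>)" by simp
  then have "exp (- real V / 2) \<le> \<delta>" using delta(1) by simp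
  then have "real (V choose k) * (1 / (4 * exp 1)) ^ k \<le> 3 * \<delta>"
    unfolding k_def by (rule binomial_exp_bound[OF V8])
  moreover have "prob F \<le> real (card {1..V} choose k) * (1 / (4 * exp 1)) ^ k"
    unfolding F_def using V8 E_event E_indep E_prob
    by (intro prob_many_events_le) (auto simp: k_def)
  ultimately have F_prob: "prob F \<le> 3 * \<delta>" by simp
  have F_event: "F \<in> events"
  proof -
    have "(\<lambda>\<omega>. card {J\<in>{1..V}. \<omega> \<in> E J}) \<in> measurable M (count_space UNIV)"
      using E_event by (intro measurable_card) auto
    then show ?thesis unfolding F_def by measurable
  qed

  \<comment> \<open>Measurability of the target event\<close>
  let ?T = "{\<omega> \<in> space M. excess_risk M (Z 0) (s_hat (K_star \<omega>) \<omega>) s_star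
    \<le> excess_risk M (Z 0) s_o s_star + L7 * (D * real V / real n)}"
  have T_event: "?T \<in> events"
  proof -
    \<comment> \<open>Splitting by the finitely many values of \<open>K_star\<close> leaves one
      fixed estimator in each piece.\<close>
    have "?T = (\<Union>K\<in>{1..V}. {\<omega>\<in>space M. K_star \<omega> = K \<and>
        excess_risk M (Z 0) (s_hat K \<omega>) s_star
          \<le> excess_risk M (Z 0) s_o s_star + L7 * (D * real V / real n)})"
      using K_star(2) by (auto simp: is_arg_min_def)
    moreover have "(\<lambda>\<omega>. excess_risk M (Z 0) (s_hat K \<omega>) s_star) \<in> borel_measurable M"
      if K: "K \<in> {1..V}" for K
      using s_hat(1)[OF K] block(1)[OF K] Z_meas L2_space_comp(1) s_star
      by (intro excess_risk_measurable[where N = N and I = "B K" and Z = Z]) force+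
    ultimately show ?thesis using K_star(1) by auto
  qed

  \<comment> \<open>Almost sure properties of the sample and comparison outside
    \<open>F\<close>\<close>
  have "AE \<omega> in M. Psi P_X S (X i \<omega>) < \<infinity>" if i: "i \<in> {1..n}" for i
  proof -
    have i': "i \<in> {0..n}" using i by auto
    have "distr M N (X i) = distr (distr M (N \<Otimes>\<^sub>M borel) (Z i)) N fst"
      unfolding X_eq using Z_meas[OF i'] by (subst distr_distr) (auto simp: comp_def)
    also have "\<dots> = distr M N (X 0)"
      unfolding X_eq ident[OF i] using Z_meas[of 0] by (subst distr_distr) (auto simp: comp_def)
    finally have "AE x in distr M N (X i). Psi P_X S x < \<infinity>" using Psi_fin unfolding P_X by (simp only:)
    then show ?thesis using X_meas[OF i'] Psi_meas by (simp add: AE_distr_iff)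
  qed
  then have "AE \<omega> in M. \<forall>i\<in>{1..n}. Psi P_X S (X i \<omega>) < \<infinity>" by (intro AE_finite_allI) auto
  moreover have "AE \<omega> in M. \<forall>K\<in>{1..V}. is_arg_min (\<lambda>t. emp_mean (B K) (\<lambda>i. Z i \<omega>) (contrast t))
      (\<lambda>t. t \<in> S) (s_hat K \<omega>)"
    using s_hat(2) by (intro AE_finite_allI) auto
  ultimately have "AE \<omega> in M. \<omega> \<in> space M - F \<longrightarrow> \<omega> \<in> ?T"
  proof eventually_elim
    case (elim \<omega>)
    show ?case
    proof
      assume \<omega>: "\<omega> \<in> space M - F"
      let ?z = "\<lambda>i. Z i \<omega>"
      define G where "G = (\<lambda>J. \<omega> \<notin> E J)"
      define u where "u = (\<lambda>K x. s_hat K \<omega> x - s_o x)"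
      define q where "q = (\<lambda>K. sqrt (\<integral>x. (u K x)\<^sup>2 \<partial>P_X))"
      define d where "d = (\<lambda>J K K'. emp_mean (B J) ?z
        (\<lambda>p. contrast (s_hat K \<omega>) p - contrast (s_hat K' \<omega>) p))"
      let ?sq = "\<lambda>J K. emp_mean (B J) ?z (\<lambda>(x, y). (u K x)\<^sup>2)"
      let ?ln = "\<lambda>J K. emp_mean (B J) ?z (\<lambda>(x, y). (y - s_o x) * u K x)"
      have s_hat_S: "s_hat K \<omega> \<in> S" if "K \<in> {1..V}" for K
        using elim(2) that by (auto simp: is_arg_min_def)
      have u_S: "u K \<in> S" if "K \<in> {1..V}" for K
        unfolding u_def by (intro linear_space_diff S s_hat_S that s_o_in_S)
      have q: "0 \<le> q K" "(q K)\<^sup>2 = (\<integral>x. (u K x)\<^sup>2 \<partial>P_X)" for K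
        by (simp_all add: q_def)
      have norm: "(q K)\<^sup>2 = (\<Sum>j<m. (\<integral>z. u K z * \<psi> j z \<partial>P_X)\<^sup>2)" if K: "K \<in> {1..V}" for K
        unfolding q using on u_S[OF K] Psi_fin basis S by (intro integral_square_basis) auto
      \<comment> \<open>The exceptional set of the expansion depends on \<open>Psi\<close> alone, so
        it is avoided by the sample points even for functions chosen from the data.\<close>
      have coord: "u K (fst (?z i)) = (\<Sum>j<m. (\<integral>z. u K z * \<psi> j z \<partial>P_X) * \<psi> j (fst (?z i)))"
        if "K \<in> {1..V}" "J \<in> {1..V}" "i \<in> B J" for K J i
      proof -
        have "i \<in> {1..n}" using block(1) that by blast
        then show ?thesis using elim(1) basis[OF u_S[OF that(1)]] by (simp add: X_eq)
      qed
      \<comment> \<open>\<open>K\<close> and \<open>J\<close> are arbitrary here and may coincide: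
        the bounds hold on all of \<open>S\<close>.\<close>
      have sq: "\<bar>?sq J K - (q K)\<^sup>2\<bar> \<le> (q K)\<^sup>2 / 2" and ln: "\<bar>?ln J K\<bar> \<le> a * q K"
        if J: "J \<in> {1..V}" "G J" and K: "K \<in> {1..V}" for J K
      proof -
        have good: "\<not> bad (B J) ?z" using J \<omega> by (simp add: G_def E_def)
        show "\<bar>?sq J K - (q K)\<^sup>2\<bar> \<le> (q K)\<^sup>2 / 2"
          unfolding norm[OF K] using good block[OF J(1)] coord[OF K J(1)]
          by (intro emp_mean_square_close[where \<psi> = \<psi>]) (auto simp: bad_def)
        have "\<bar>?ln J K\<bar> \<le> a * sqrt ((q K)\<^sup>2)"
          unfolding norm[OF K] using good a(1) coord[OF K J(1)]
          by (intro emp_mean_linear_le[where \<psi> = \<psi>]) (auto simp: bad_def)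
        then show "\<bar>?ln J K\<bar> \<le> a * q K" using q(1) by simp
      qed
      have d_eq: "d J K K' = ?sq J K - ?sq J K' - 2 * (?ln J K - ?ln J K')" for J K K'
        unfolding d_def u_def by (rule emp_mean_contrast_diff)
      have "q (K_star \<omega>) \<le> 9 * a"
      proof (rule median_selection_bound[where d = d and G = G and
            med = "\<lambda>K K'. P_med K K' (\<lambda>z. contrast (s_hat K \<omega>) z - contrast (s_hat K' \<omega>) z) \<omega>"])
        have "card {J\<in>{1..V}. \<omega> \<in> E J} < k" using \<omega> by (auto simp: F_def not_le)
        then show "2 * card {J\<in>{1..V}. \<not> G J} + 2 < V"
          unfolding G_def k_def using V8 by simp
      next
        fix J K K' assume JK: "J \<in> {1..V}" "K \<in> {1..V}" "K' \<in> {1..V}" "G J"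
        have eq: "2 * a * (q K + q K') = 2 * (a * q K + a * q K')" by (simp add: algebra_simps)
        show "d J K K' \<le> 3 / 2 * (q K)\<^sup>2 - (q K')\<^sup>2 / 2 + 2 * a * (q K + q K')"
          "(q K)\<^sup>2 / 2 - 3 / 2 * (q K')\<^sup>2 - 2 * a * (q K + q K') \<le> d J K K'"
          unfolding d_eq eq
          by (rule quadratic_gap_bounds[OF sq[OF JK(1,4,2)] sq[OF JK(1,4,3)]
              ln[OF JK(1,4,2)] ln[OF JK(1,4,3)]])+
      next
        fix K assume K: "K \<in> {1..V}" "G K"
        \<comment> \<open>On its own good block the estimator satisfies q^2 / 2 \<le>
          \<open>?sq K K\<close> = \<open>?ln K K\<close> \<le> a q, whence q \<le> 2 a.\<close>
        have "?sq K K = ?ln K K"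
          unfolding u_def using S(2) s_o_in_S elim(2) K(1) by (intro arg_min_normal_equation) auto
        then have "q K * q K \<le> 2 * a * q K"
          using sq[OF K K(1)] ln[OF K K(1)] unfolding power2_eq_square by linarith
        then show "q K \<le> 2 * a" using q(1)[of K] a(1)
          by (cases "q K = 0") (auto simp: mult_le_cancel_right)
      next
        \<comment> \<open>\<open>P_med\<close> is a median for every \<open>f\<close> at each
          outcome, so the realised difference of contrasts may be inserted.\<close>
        show "is_median ({1..V} - {K, K'}) (\<lambda>J. d J K K')
            (P_med K K' (\<lambda>z. contrast (s_hat K \<omega>) z - contrast (s_hat K' \<omega>) z) \<omega>)"
          if "K \<in> {1..V}" "K' \<in> {1..V}" for K K'
          unfolding d_def using P_med[OF that] \<omega> by auto
      qed (use a q K_star(2) \<omega> in auto)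
      then have "(q (K_star \<omega>))\<^sup>2 \<le> (9 * a)\<^sup>2" using q(1) by (intro power_mono)
      \<comment> \<open>972 = 81 * 12, from the factor 9 and the constant in
        \<open>a\<close>.\<close>
      also have "\<dots> = 972 * exp 1 * (D * V / n)" by (simp add: power_mult_distrib a)
      also have "\<dots> \<le> L7 * (D * V / n)"
        using D(1) by (intro mult_right_mono L7_lower_bound) auto
      finally have "(\<integral>x. (u (K_star \<omega>) x)\<^sup>2 \<partial>P_X) \<le> L7 * (D * V / n)" by (simp add: q)
      moreover have "K_star \<omega> \<in> {1..V}" using K_star(2) \<omega> by (auto simp: is_arg_min_def)
      ultimately show "\<omega> \<in> ?T"
        using excess_risk_projection[OF s_hat_S] \<omega> by (auto simp: Z0 u_def)
    qed
  qed
  then have "prob (space M - F) \<le> prob ?T"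
    using T_event by (intro finite_measure_mono_AE) auto
  then show ?thesis using F_prob F_event by (simp add: prob_compl)
qed

end
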